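(* Let $\alpha>0$, $\sigma>0$, let $\rho$ be an $\alpha$-super log-concave measure on $\mathbb{R}^d$ and let $p_\sigma(x)=\exp\left(-\frac{1}{2\sigma}|x|^2\right)$. Then, for any $\delta>0$ satisfying $$\frac1\delta-\frac1\alpha>\sigma,$$ the measure $\rho\star p_\sigma$ is $\delta$-super log-concave.
   Context: Measure on $\mathbb{R}^d$ means positive Radon measure; $\rho\star p_\sigma$ is the measure with Lebesgue density $x\mapsto\int p_\sigma(x-y)\rho(dy)$. A function $\theta:\mathbb{R}^d\to[0,\infty)$ is log-concave if $\theta(sx+ty)\ge\theta(x)^s\theta(y)^t$ for all $x,y$ and $s,t\ge0$, $s+t=1$ (zero values are allowed). A measure $\nu$ on $\mathbb{R}^d$ is log-concave if for every log-concave continuous function $\theta$ of compact support the convolution $\theta\star\nu$ has a log-concave density with respect to Lebesgue measure. A measure $\rho$ is $\alpha$-super log-concave if $e^{\frac{\alpha}{2}|x|^2}\rho(dx)$ is log-concave, $|\cdot|$ being the Euclidean norm. *)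

theory Defs
  imports "HOL-Analysis.Analysis"
begin

text \<open>On a Euclidean space a Borel measure that is finite on compact sets is automatically
  inner and outer regular, so regularity is not demanded separately.\<close>

definition radon_measure :: "'a::euclidean_space measure \<Rightarrow> bool" where
  "radon_measure \<nu> \<longleftrightarrow>
     sets \<nu> = sets borel \<and> (\<forall>K. compact K \<longrightarrow> emeasure \<nu> K < \<infinity>)"

text \<open>The convention \<open>0 powr 0 = 0\<close> is harmless: in the cases \<open>s = 0\<close> and \<open>t = 0\<close>
  the inequality is trivially true both with it and with \<open>0 powr 0 = 1\<close>.\<close>

definition log_concave_fun :: "('a::euclidean_space \<Rightarrow> real) \<Rightarrow> bool" where
  "log_concave_fun \<theta> \<longleftrightarrow>
     (\<forall>x. 0 \<le> \<theta> x) \<and>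
     (\<forall>x y s t. 0 \<le> s \<longrightarrow> 0 \<le> t \<longrightarrow> s + t = 1 \<longrightarrow>
        \<theta> (s *\<^sub>R x + t *\<^sub>R y) \<ge> \<theta> x powr s * \<theta> y powr t)"

text \<open>The convolution of a nonnegative function with a measure, as a measure. The integral
  is taken in the extended nonnegative reals, so no finiteness is presupposed.\<close>

definition conv_measure :: "('a::euclidean_space \<Rightarrow> real) \<Rightarrow> 'a measure \<Rightarrow> 'a measure" where
  "conv_measure f \<nu> = density lborel (\<lambda>x. \<integral>\<^sup>+ y. ennreal (f (x - y)) \<partial>\<nu>)"

text \<open>Asking for a Borel version of the log-concave density is no restriction: replacing
  a log-concave function by \<open>0\<close> outside the interior of its convex support changes
  it on a null set only, keeps it log-concave and makes it Borel measurable.\<close>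

definition has_log_concave_density :: "'a::euclidean_space measure \<Rightarrow> bool" where
  "has_log_concave_density \<mu> \<longleftrightarrow>
     (\<exists>g \<in> borel_measurable borel. log_concave_fun g \<and> \<mu> = density lborel (\<lambda>x. ennreal (g x)))"

definition log_concave_measure :: "'a::euclidean_space measure \<Rightarrow> bool" where
  "log_concave_measure \<nu> \<longleftrightarrow>
     radon_measure \<nu> \<and>
     (\<forall>\<theta>. log_concave_fun \<theta> \<longrightarrow> continuous_on UNIV \<theta> \<longrightarrow> compact (closure {x. \<theta> x \<noteq> 0}) \<longrightarrow>
        has_log_concave_density (conv_measure \<theta> \<nu>))"

definition super_log_concave_measure :: "real \<Rightarrow> 'a::euclidean_space measure \<Rightarrow> bool" where
  "super_log_concave_measure \<alpha> \<rho> \<longleftrightarrow>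
     radon_measure \<rho> \<and>
     log_concave_measure (density \<rho> (\<lambda>x. ennreal (exp (\<alpha> / 2 * (norm x)\<^sup>2))))"

definition gauss_kernel :: "real \<Rightarrow> 'a::euclidean_space \<Rightarrow> real" where
  "gauss_kernel \<sigma> x = exp (- (1 / (2 * \<sigma>)) * (norm x)\<^sup>2)"

end

theory Submission
  imports Defs "HOL-Probability.Distributions"
begin

text \<open>Write \<open>\<nu> = exp (\<alpha> |y|\<^sup>2 / 2) \<rho>(dy)\<close>, a log-concave measure. Completing the square in
  \<open>|x - y|\<^sup>2 / (2 \<sigma>) + \<alpha> |y|\<^sup>2 / 2\<close> as a quadratic function of \<open>y\<close> (\<open>complete_the_square\<close>) shows that the
  convolution of \<open>\<rho>\<close> with the Gaussian has the density \<open>exp (- \<beta> |x|\<^sup>2) \<Phi>(\<kappa> x)\<close>, where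
  \<open>\<beta> = (1/2) / (\<sigma> + 1/\<alpha>)\<close>, \<open>\<kappa> = 1 / (1 + \<alpha> \<sigma>)\<close>, and \<open>\<Phi>\<close> is the convolution of a Gaussian with \<open>\<nu>\<close>.
  The condition on \<open>\<delta>\<close> says \<open>\<delta> / 2 < \<beta>\<close>. So after multiplication with \<open>exp (\<delta> |x|\<^sup>2 / 2)\<close> there remains a
  Gaussian factor of nonnegative rate, and log-concavity of the density reduces to that of \<open>\<Phi>\<close>.

  The function \<open>\<Phi>\<close> is log-concave because it is an increasing limit of convolutions of \<open>\<nu>\<close> with
  truncated Gaussians, which are admissible test functions in the definition of a log-concave measure
  (\<open>convolve_gaussian_log_concave\<close>). The definition only gives densities up to null sets; continuity of the
  convolution removes the exceptional set (\<open>convolve_log_concave\<close>). Finiteness of \<open>\<Phi>\<close> is a separate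
  matter: it holds because a log-concave function grows at most exponentially
  (\<open>log_concave_exponential_growth\<close>), so that Gaussians are integrable with respect to \<open>\<nu>\<close>
  (\<open>log_concave_measure_gaussian_integral_finite\<close>).

  It remains to see that a measure with a log-concave, locally bounded density is a log-concave measure
  (\<open>log_concave_measure_density\<close>), that is, that convolution preserves log-concavity of functions. This
  is Prekopa's theorem (\<open>Prekopa\<close>): integrating out some variables of a log-concave function
  leaves a log-concave function. One direction at a time, it reduces to the Prekopa-Leindler
  inequality on the line, which compares the superlevel sets of three functions through the
  Brunn-Minkowski inequality for sets of reals (\<open>Brunn_Minkowski_line\<close>).\<close>

section \<open>The Prekopa-Leindler inequality on the line\<close>

text \<open>A set of reals lies in the interval between its infimum and its supremum.\<close>

lemma emeasure_lborel_le_diameter: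
  fixes A :: "real set"
  assumes "A \<noteq> {}" and diff: "\<And>u v. u \<in> A \<Longrightarrow> v \<in> A \<Longrightarrow> v - u \<le> d"
  shows "emeasure lborel A \<le> ennreal d"
proof -
  obtain w where w: "w \<in> A" using assms by auto
  have ba: "bdd_above A" using diff[OF w] by (intro bdd_aboveI[of _ "w + d"]) (auto simp: algebra_simps)
  have bb: "bdd_below A" using diff[OF _ w] by (intro bdd_belowI[of _ "w - d"]) (auto simp: algebra_simps)
  have "Sup A - d \<le> v" if "v \<in> A" for v
    using cSup_least[OF \<open>A \<noteq> {}\<close>, of "v + d"] diff[OF that] by (fastforce simp: algebra_simps)
  then have "Sup A - d \<le> Inf A" using \<open>A \<noteq> {}\<close> by (intro cInf_greatest)
  moreover have "A \<subseteq> {Inf A..Sup A}" using ba bb by (auto intro: cInf_lower cSup_upper)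
  moreover have "Inf A \<le> Sup A" using calculation(2) w by auto
  ultimately have "emeasure lborel A \<le> ennreal (Sup A - Inf A)"
    using emeasure_mono[of A "{Inf A..Sup A}" lborel] by simp
  also have "\<dots> \<le> ennreal d" using \<open>Sup A - d \<le> Inf A\<close> by (intro ennreal_leI) auto
  finally show ?thesis .
qed

text \<open>Since \<open>C\<close> is an interval, it contains the segment that joins the combination of two left points to
  the combination of two right points, and this segment has length
  \<open>s (v1 - u1) + t (v2 - u2)\<close>. Taking the supremum over the points of \<open>A\<close>, then over those of \<open>B\<close>, turns
  the two differences into bounds for the measures. Superlevel sets of log-concave functions are convex,
  so this case carries the whole theory below.\<close>

lemma Brunn_Minkowski_line:
  fixes A B C :: "real set"
  assumes ne: "A \<noteq> {}" "B \<noteq> {}" and C: "convex C" "C \<in> sets borel" and st: "0 < s" "0 < t"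
    and sub: "\<And>u v. u \<in> A \<Longrightarrow> v \<in> B \<Longrightarrow> s * u + t * v \<in> C"
  shows "ennreal s * emeasure lborel A + ennreal t * emeasure lborel B \<le> emeasure lborel C"
proof (cases "emeasure lborel C")
  case top then show ?thesis by simp
next
  case (real c)
  have le: "s * (v1 - u1) + t * (v2 - u2) \<le> c"
    if "u1 \<in> A" "v1 \<in> A" "u2 \<in> B" "v2 \<in> B" "u1 \<le> v1" "u2 \<le> v2" for u1 v1 u2 v2
  proof -
    have ord: "s * u1 + t * u2 \<le> s * v1 + t * v2"
      using that st by (intro add_mono mult_left_mono) auto
    then have "{s * u1 + t * u2 .. s * v1 + t * v2} \<subseteq> C"
      using closed_segment_subset[OF sub[OF that(1,3)] sub[OF that(2,4)] C(1)]
      by (simp add: closed_segment_eq_real_ivl)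
    from emeasure_mono[OF this, of lborel] C(2)
    have "ennreal ((s * v1 + t * v2) - (s * u1 + t * u2)) \<le> ennreal c"
      using real ord by simp
    then show ?thesis using real by (simp add: algebra_simps ennreal_le_iff)
  qed
  \<comment> \<open>Swapping the two points where they are in the wrong order only increases the left-hand side.\<close>
  have le': "s * (v1 - u1) + t * (v2 - u2) \<le> c"
    if "u1 \<in> A" "v1 \<in> A" "u2 \<in> B" "v2 \<in> B" for u1 v1 u2 v2
  proof -
    have "s * (v1 - u1) + t * (v2 - u2) \<le> s * (max u1 v1 - min u1 v1) + t * (max u2 v2 - min u2 v2)"
      using st by (intro add_mono mult_left_mono) auto
    also have "\<dots> \<le> c"
      using that by (intro le) (auto simp: max_def min_def)
    finally show ?thesis .
  qed
  have A: "emeasure lborel A \<le> ennreal ((c - t * (v2 - u2)) / s)" if "u2 \<in> B" "v2 \<in> B" for u2 v2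
    using le'[OF _ _ that] st by (intro emeasure_lborel_le_diameter ne) (simp add: field_simps)
  obtain w where w: "w \<in> B" using ne by auto
  obtain r where r: "emeasure lborel A = ennreal r" "0 \<le> r"
    using A[OF w w] by (cases "emeasure lborel A") (auto simp: top_unique)
  obtain w' where w': "w' \<in> A" using ne by auto
  have nonneg: "0 \<le> c - t * (v2 - u2)" if "u2 \<in> B" "v2 \<in> B" for u2 v2
    using le'[OF w' w' that] by simp
  have B: "v2 - u2 \<le> (c - s * r) / t" if "u2 \<in> B" "v2 \<in> B" for u2 v2
  proof -
    have "r \<le> (c - t * (v2 - u2)) / s"
      using A[OF that] nonneg[OF that] st r by (simp add: ennreal_le_iff)
    then show ?thesis using st by (simp add: field_simps)
  qed
  have nn: "0 \<le> (c - s * r) / t" using B[OF w w] by simp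
  have "emeasure lborel B \<le> ennreal ((c - s * r) / t)"
    using B by (intro emeasure_lborel_le_diameter ne)
  then have "ennreal t * emeasure lborel B \<le> ennreal t * ennreal ((c - s * r) / t)"
    by (intro mult_left_mono) auto
  also have "\<dots> = ennreal (c - s * r)" using st nn by (simp flip: ennreal_mult)
  finally have "ennreal s * emeasure lborel A + ennreal t * emeasure lborel B
      \<le> ennreal (s * r) + ennreal (c - s * r)"
    using st r by (intro add_mono) (simp_all add: ennreal_mult)
  also have "\<dots> = ennreal c" using st r nn by (subst ennreal_plus[symmetric]) (auto simp: field_simps)
  finally show ?thesis using real by simp
qed

lemma nn_integral_layer_cake:
  assumes "sigma_finite_measure M" and [measurable]: "f \<in> borel_measurable M"
  shows "(\<integral>\<^sup>+x. f x \<partial>M)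
    = (\<integral>\<^sup>+l. indicator {0<..} l * emeasure M {x \<in> space M. ennreal l < f x} \<partial>lborel)"
proof -
  interpret M: sigma_finite_measure M by fact
  interpret P: pair_sigma_finite M "lborel :: real measure" ..
  have slice: "f x = (\<integral>\<^sup>+l. indicator {0<..} l * indicator {l. ennreal l < f x} l \<partial>lborel)" for x
  proof (cases "f x")
    case top
    then have "(\<integral>\<^sup>+l. indicator {0<..} l * indicator {l. ennreal l < f x} l \<partial>lborel)
        = (\<integral>\<^sup>+l. indicator {0::real<..} l \<partial>lborel)"
      by (intro nn_integral_cong) (auto simp: indicator_def)
    also have "\<dots> = \<infinity>"
    proof -
      have "ennreal n \<le> emeasure lborel {0::real<..}" if "n \<ge> 0" for n
      proof -
        have "emeasure lborel {0<..n} \<le> emeasure lborel {0::real<..}"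
          by (intro emeasure_mono) auto
        then show ?thesis using that by simp
      qed
      from this[of "enn2real (emeasure lborel {0::real<..}) + 1"] show ?thesis
        by (cases "emeasure lborel {0::real<..}") (auto simp: ennreal_le_iff simp flip: ennreal_1 ennreal_plus)
    qed
    finally show ?thesis using top by simp
  next
    case (real r)
    then have "(\<integral>\<^sup>+l. indicator {0<..} l * indicator {l. ennreal l < f x} l \<partial>lborel)
        = (\<integral>\<^sup>+l. indicator {0<..<r} l \<partial>lborel)"
      by (intro nn_integral_cong) (auto simp: indicator_def ennreal_less_iff)
    then show ?thesis using real by simp
  qed
  have "(\<integral>\<^sup>+x. f x \<partial>M) = (\<integral>\<^sup>+x. (\<integral>\<^sup>+l. indicator {0<..} l * indicator {l. ennreal l < f x} l \<partial>lborel) \<partial>M)"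
    using slice by (intro nn_integral_cong) auto
  also have "\<dots> = (\<integral>\<^sup>+l. (\<integral>\<^sup>+x. indicator {0<..} l * indicator {l. ennreal l < f x} l \<partial>M) \<partial>lborel)"
    by (rule P.Fubini'[symmetric]) (simp add: indicator_def, measurable)
  also have "\<dots> = (\<integral>\<^sup>+l. indicator {0<..} l * emeasure M {x \<in> space M. ennreal l < f x} \<partial>lborel)"
  proof (intro nn_integral_cong)
    fix l :: real
    have "(\<integral>\<^sup>+x. indicator {0<..} l * indicator {l. ennreal l < f x} l \<partial>M)
        = (\<integral>\<^sup>+x. indicator {0<..} l * indicator {x \<in> space M. ennreal l < f x} x \<partial>M)"
      by (intro nn_integral_cong) (auto simp: indicator_def)
    then show "(\<integral>\<^sup>+x. indicator {0<..} l * indicator {l. ennreal l < f x} l \<partial>M)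
        = indicator {0<..} l * emeasure M {x \<in> space M. ennreal l < f x}"
      by (simp add: nn_integral_cmult)
  qed
  finally show ?thesis .
qed

text \<open>When both suprema are \<open>1\<close>, the superlevel sets of \<open>f\<close> and \<open>g\<close> are nonempty for exactly the same
  levels, those below \<open>1\<close>. The Brunn-Minkowski inequality therefore holds level by level, and the
  layer-cake formula adds the levels up.\<close>

lemma Prekopa_Leindler_line_normalized:
  fixes f g h :: "real \<Rightarrow> ennreal"
  assumes [measurable]: "f \<in> borel_measurable borel" "g \<in> borel_measurable borel" "h \<in> borel_measurable borel"
    and st: "0 < s" "0 < t"
    and sup: "(SUP u. f u) = 1" "(SUP v. g v) = 1"
    and conv: "\<And>l. 0 < l \<Longrightarrow> convex {w. ennreal l < h w}"
    and sub: "\<And>u v l. 0 < l \<Longrightarrow> ennreal l < f u \<Longrightarrow> ennreal l < g v \<Longrightarrow> ennreal l < h (s * u + t * v)"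
  shows "ennreal s * (\<integral>\<^sup>+u. f u \<partial>lborel) + ennreal t * (\<integral>\<^sup>+v. g v \<partial>lborel) \<le> (\<integral>\<^sup>+w. h w \<partial>lborel)"
proof -
  let ?L = "\<lambda>f l. emeasure lborel {x. ennreal l < f x}"
  have cake: "(\<integral>\<^sup>+u. k u \<partial>lborel) = (\<integral>\<^sup>+l. indicator {0<..} l * ?L k l \<partial>lborel)"
    if "k \<in> borel_measurable borel" for k :: "real \<Rightarrow> ennreal"
    using nn_integral_layer_cake[OF sigma_finite_lborel, of k] that by simp
  have meas [measurable]: "?L k \<in> borel_measurable borel" if [measurable]: "k \<in> borel_measurable borel"
    for k :: "real \<Rightarrow> ennreal"
  proof -
    have "{x. ennreal l < k x} = Pair l -` {p. ennreal (fst p) < k (snd p)}" for l by auto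
    moreover have "{p \<in> space (borel \<Otimes>\<^sub>M lborel). ennreal (fst p) < k (snd p)} \<in> sets (borel \<Otimes>\<^sub>M lborel)"
      by measurable
    then have "{p. ennreal (fst p) < k (snd p)} \<in> sets (borel \<Otimes>\<^sub>M lborel)"
      by (simp add: space_pair_measure)
    ultimately show ?thesis
      using lborel.measurable_emeasure_Pair[of "{p. ennreal (fst p) < k (snd p)}" "borel :: real measure"] by simp
  qed
  have "ennreal s * (\<integral>\<^sup>+u. f u \<partial>lborel) + ennreal t * (\<integral>\<^sup>+v. g v \<partial>lborel)
      = (\<integral>\<^sup>+l. ennreal s * (indicator {0<..} l * ?L f l) + ennreal t * (indicator {0<..} l * ?L g l) \<partial>lborel)"
    by (subst cake[OF assms(1)], subst cake[OF assms(2)]) (simp add: nn_integral_add nn_integral_cmult)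
  also have "\<dots> \<le> (\<integral>\<^sup>+l. indicator {0<..} l * ?L h l \<partial>lborel)"
  proof (intro nn_integral_mono)
    fix l :: real
    show "ennreal s * (indicator {0<..} l * ?L f l) + ennreal t * (indicator {0<..} l * ?L g l)
        \<le> indicator {0<..} l * ?L h l"
    proof (cases "0 < l \<and> l < 1")
      case True
      then have l: "ennreal l < 1" by (simp flip: ennreal_1 add: ennreal_less_iff)
      have "{u. ennreal l < f u} \<noteq> {}" "{v. ennreal l < g v} \<noteq> {}"
        using l sup less_SUP_iff[of "ennreal l" f UNIV] less_SUP_iff[of "ennreal l" g UNIV] by auto
      moreover have "{w. ennreal l < h w} \<in> sets borel" by measurable
      ultimately have "ennreal s * ?L f l + ennreal t * ?L g l \<le> ?L h l"
        using True st sub conv by (intro Brunn_Minkowski_line) auto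
      then show ?thesis using True by simp
    next
      case False
      \<comment> \<open>Above level \<open>1\<close> the left-hand side vanishes.\<close>
      have "?L k l = 0" if "(SUP u. k u) = 1" "0 < l" for k :: "real \<Rightarrow> ennreal"
      proof -
        have "k u \<le> ennreal l" for u
          using False that SUP_upper[of u UNIV k] ennreal_leI[of 1 l] by (auto intro: order_trans)
        then have "{x. ennreal l < k x} = {}" by (auto simp: not_less)
        then show ?thesis by simp
      qed
      from this[OF sup(1)] this[OF sup(2)] show ?thesis
        by (cases "0 < l") auto
    qed
  qed
  also have "\<dots> = (\<integral>\<^sup>+w. h w \<partial>lborel)" by (rule cake[OF assms(3), symmetric])
  finally show ?thesis .
qed

text \<open>Dividing \<open>f\<close>, \<open>g\<close> and \<open>h\<close> by \<open>p\<close>, \<open>q\<close> and \<open>p\<^sup>s q\<^sup>t\<close>, with \<open>p\<close> and \<open>q\<close> the suprema of \<open>f\<close> and \<open>g\<close>,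
  leads to the normalized case, which bounds the integral of \<open>h\<close> below by an arithmetic mean; the
  weighted arithmetic-geometric inequality gives back the geometric mean. Boundedness makes the
  suprema finite.

  The conclusion speaks of reals \<open>a\<close>, \<open>b\<close> below the integrals, because the integrals may be infinite.\<close>

lemma Prekopa_Leindler_line_bounded:
  fixes f g h :: "real \<Rightarrow> ennreal"
  assumes [measurable]: "f \<in> borel_measurable borel" "g \<in> borel_measurable borel" "h \<in> borel_measurable borel"
    and st: "0 < s" "0 < t" "s + t = 1"
    and bound: "\<And>u. f u \<le> ennreal n" "\<And>v. g v \<le> ennreal n"
    and conv: "\<And>l. 0 < l \<Longrightarrow> convex {w. ennreal l < h w}"
    and sub: "\<And>u v a b. 0 < a \<Longrightarrow> 0 < b \<Longrightarrow> ennreal a < f u \<Longrightarrow> ennreal b < g v \<Longrightarrow>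
        ennreal (a powr s * b powr t) < h (s * u + t * v)"
    and ab: "0 < a" "0 < b" "ennreal a < (\<integral>\<^sup>+u. f u \<partial>lborel)" "ennreal b < (\<integral>\<^sup>+v. g v \<partial>lborel)"
  shows "ennreal (a powr s * b powr t) \<le> (\<integral>\<^sup>+w. h w \<partial>lborel)"
proof -
  have ess: "\<exists>m>0. (SUP u. k u) = ennreal m"
    if "\<And>u. k u \<le> ennreal n" "ennreal c < (\<integral>\<^sup>+u. k u \<partial>lborel)" for k :: "real \<Rightarrow> ennreal" and c
  proof -
    have "(SUP u. k u) \<le> ennreal n" using that(1) by (intro SUP_least)
    then obtain m where m: "(SUP u. k u) = ennreal m" "0 \<le> m"
      by (cases "SUP u. k u") (auto simp: top_unique)
    have "m \<noteq> 0"
    proof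
      assume "m = 0"
      then have "k u = 0" for u using m SUP_upper[of u UNIV k] by auto
      then show False using that(2) by simp
    qed
    then show ?thesis using m by (intro exI[of _ m]) auto
  qed
  obtain p where p: "0 < p" "(SUP u. f u) = ennreal p" using ess[OF bound(1) ab(3)] by blast
  obtain q where q: "0 < q" "(SUP u. g u) = ennreal q" using ess[OF bound(2) ab(4)] by blast
  define K where "K = p powr s * q powr t"
  have K: "0 < K" using p q by (simp add: K_def)
  have cancel: "ennreal l < ennreal (1 / c) * y \<longleftrightarrow> ennreal (c * l) < y" if "0 < c" "0 < l" for c l y
    using that by (cases y) (simp_all add: ennreal_less_iff field_simps ennreal_mult_top flip: ennreal_mult)
  have "ennreal s * (\<integral>\<^sup>+u. ennreal (1 / p) * f u \<partial>lborel) + ennreal t * (\<integral>\<^sup>+v. ennreal (1 / q) * g v \<partial>lborel)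
      \<le> (\<integral>\<^sup>+w. ennreal (1 / K) * h w \<partial>lborel)"
  proof (rule Prekopa_Leindler_line_normalized)
    show "(SUP u. ennreal (1 / p) * f u) = 1" "(SUP u. ennreal (1 / q) * g u) = 1"
      using p q by (simp_all flip: SUP_mult_left_ennreal ennreal_mult)
    show "convex {w. ennreal l < ennreal (1 / K) * h w}" if "0 < l" for l
      using conv[of "K * l"] K that by (simp add: cancel)
    show "ennreal l < ennreal (1 / K) * h (s * u + t * v)"
      if l: "0 < l" and "ennreal l < ennreal (1 / p) * f u" "ennreal l < ennreal (1 / q) * g v" for u v l
    proof -
      have "ennreal ((p * l) powr s * (q * l) powr t) < h (s * u + t * v)"
        using that p q by (intro sub) (simp_all add: cancel)
      moreover have "(p * l) powr s * (q * l) powr t = K * l"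
        using p q l st powr_add[of l s t] by (simp add: K_def powr_mult)
      ultimately show ?thesis using K l by (simp add: cancel)
    qed
  qed (use st in auto)
  also have "\<dots> = ennreal (1 / K) * (\<integral>\<^sup>+w. h w \<partial>lborel)" by (simp add: nn_integral_cmult)
  finally have main: "ennreal s * (ennreal (1 / p) * (\<integral>\<^sup>+u. f u \<partial>lborel))
      + ennreal t * (ennreal (1 / q) * (\<integral>\<^sup>+v. g v \<partial>lborel)) \<le> ennreal (1 / K) * (\<integral>\<^sup>+w. h w \<partial>lborel)"
    by (simp add: nn_integral_cmult)
  have "a powr s * b powr t = K * ((a / p) powr s * (b / q) powr t)"
    using ab p q by (simp add: K_def powr_divide)
  also have "\<dots> \<le> K * (s * (a / p) + t * (b / q))"
    using K ab p q st by (intro mult_left_mono Youngs_inequality_0) auto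
  finally have "ennreal (a powr s * b powr t) \<le> ennreal (K * (s * (a / p) + t * (b / q)))"
    by (rule ennreal_leI)
  also have "\<dots> = ennreal K * (ennreal s * (ennreal (1 / p) * ennreal a) + ennreal t * (ennreal (1 / q) * ennreal b))"
    using K ab p q st by (simp flip: ennreal_mult ennreal_plus)
  also have "\<dots> \<le> ennreal K * (ennreal (1 / K) * (\<integral>\<^sup>+w. h w \<partial>lborel))"
    using ab(3,4) by (intro mult_left_mono order_trans[OF _ main] add_mono) auto
  also have "\<dots> = (\<integral>\<^sup>+w. h w \<partial>lborel)"
    using K by (simp flip: mult.assoc ennreal_mult)
  finally show ?thesis .
qed

text \<open>Truncating \<open>f\<close> and \<open>g\<close> preserves the hypotheses and, by monotone convergence, the strict lower
  bounds on their integrals.\<close>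

lemma Prekopa_Leindler_line:
  fixes f g h :: "real \<Rightarrow> ennreal"
  assumes [measurable]: "f \<in> borel_measurable borel" "g \<in> borel_measurable borel" "h \<in> borel_measurable borel"
    and st: "0 < s" "0 < t" "s + t = 1"
    and conv: "\<And>l. 0 < l \<Longrightarrow> convex {w. ennreal l < h w}"
    and sub: "\<And>u v a b. 0 < a \<Longrightarrow> 0 < b \<Longrightarrow> ennreal a < f u \<Longrightarrow> ennreal b < g v \<Longrightarrow>
        ennreal (a powr s * b powr t) < h (s * u + t * v)"
    and ab: "0 < a" "0 < b" "ennreal a < (\<integral>\<^sup>+u. f u \<partial>lborel)" "ennreal b < (\<integral>\<^sup>+v. g v \<partial>lborel)"
  shows "ennreal (a powr s * b powr t) \<le> (\<integral>\<^sup>+w. h w \<partial>lborel)"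
proof -
  have trunc: "\<exists>n::nat. \<forall>n'. n \<le> n' \<longrightarrow> ennreal c < (\<integral>\<^sup>+u. min (k u) (ennreal (real n')) \<partial>lborel)"
    if [measurable]: "k \<in> borel_measurable borel" and c: "ennreal c < (\<integral>\<^sup>+u. k u \<partial>lborel)"
    for k :: "real \<Rightarrow> ennreal" and c
  proof -
    have inc: "incseq (\<lambda>n u. min (k u) (ennreal (real n)))"
      by (auto simp: incseq_def le_fun_def intro: min.coboundedI2 ennreal_leI)
    have "(SUP n. min (k u) (ennreal (real n))) = k u" for u
    proof -
      have "(SUP n. min (k u) (ennreal (real n))) = min (k u) (SUP n. ennreal (real n))"
        by (simp add: inf_SUP flip: inf_min)
      then show ?thesis by (simp add: ennreal_SUP_of_nat_eq_top flip: ennreal_of_nat_eq_real_of_nat)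
    qed
    then have "(\<integral>\<^sup>+u. k u \<partial>lborel) = (SUP n. \<integral>\<^sup>+u. min (k u) (ennreal (real n)) \<partial>lborel)"
      using nn_integral_monotone_convergence_SUP[OF inc, of lborel] by simp
    then obtain n where n: "ennreal c < (\<integral>\<^sup>+u. min (k u) (ennreal (real n)) \<partial>lborel)"
      using c by (auto simp: less_SUP_iff)
    have "(\<integral>\<^sup>+u. min (k u) (ennreal (real n)) \<partial>lborel) \<le> (\<integral>\<^sup>+u. min (k u) (ennreal (real n')) \<partial>lborel)"
      if "n' \<ge> n" for n'
      using incseqD[OF inc that] by (intro nn_integral_mono) (auto simp: le_fun_def)
    then show ?thesis using n by (auto intro: less_le_trans)
  qed
  obtain n1 n2 :: nat where
    "\<forall>n'. n1 \<le> n' \<longrightarrow> ennreal a < (\<integral>\<^sup>+u. min (f u) (ennreal (real n')) \<partial>lborel)"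
    "\<forall>n'. n2 \<le> n' \<longrightarrow> ennreal b < (\<integral>\<^sup>+u. min (g u) (ennreal (real n')) \<partial>lborel)"
    using trunc[OF assms(1) ab(3)] trunc[OF assms(2) ab(4)] by blast
  then have "ennreal a < (\<integral>\<^sup>+u. min (f u) (ennreal (real (max n1 n2))) \<partial>lborel)"
    "ennreal b < (\<integral>\<^sup>+u. min (g u) (ennreal (real (max n1 n2))) \<partial>lborel)"
    by auto
  then show ?thesis
    using ab st conv sub by (intro Prekopa_Leindler_line_bounded[where n = "max n1 n2"
        and f = "\<lambda>u. min (f u) (ennreal (real (max n1 n2)))" and g = "\<lambda>u. min (g u) (ennreal (real (max n1 n2)))"]) auto
qed

section \<open>Log-concave functions with extended values and Prekopa's theorem\<close>

text \<open>Log-concavity for functions that may take the value \<open>\<infinity>\<close>, expressed by positive real lower bounds. Strict inequalities in the hypotheses make the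
  notion stable under increasing suprema (\<open>log_concave_ennreal_SUP\<close>), where nonstrict ones would not
  transfer to a member of the sequence. The boundary cases \<open>s = 0\<close>, \<open>t = 0\<close>, \<open>a = 0\<close> and \<open>b = 0\<close>
  carry no information.\<close>

definition log_concave_ennreal :: "('a::real_vector \<Rightarrow> ennreal) \<Rightarrow> bool" where
  "log_concave_ennreal H \<longleftrightarrow> (\<forall>x y s t a b. 0 < s \<longrightarrow> 0 < t \<longrightarrow> s + t = 1 \<longrightarrow> 0 < a \<longrightarrow> 0 < b \<longrightarrow>
     ennreal a < H x \<longrightarrow> ennreal b < H y \<longrightarrow>
     ennreal (a powr s * b powr t) \<le> H (s *\<^sub>R x + t *\<^sub>R y))"

lemma log_concave_ennrealD:
  assumes "log_concave_ennreal H" "0 < s" "0 < t" "s + t = 1" "0 < a" "0 < b"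
    "ennreal a < H x" "ennreal b < H y"
  shows "ennreal (a powr s * b powr t) \<le> H (s *\<^sub>R x + t *\<^sub>R y)"
  using assms unfolding log_concave_ennreal_def by blast

text \<open>Raising \<open>a\<close> slightly makes the conclusion strict, which is the form in which superlevel sets are
  compared.\<close>

lemma log_concave_ennreal_less:
  assumes H: "log_concave_ennreal H" and st: "0 < s" "0 < t" "s + t = 1" and ab: "0 < a" "0 < b"
    "ennreal a < H x" "ennreal b < H y"
  shows "ennreal (a powr s * b powr t) < H (s *\<^sub>R x + t *\<^sub>R y)"
proof -
  obtain r where "ennreal a < r" "r < H x" using ab dense by blast
  then obtain a' where a': "a < a'" "ennreal a' < H x"
    using ab by (cases r) (auto simp: ennreal_less_iff)
  have "a powr s < a' powr s" using a' ab st by (intro powr_less_mono2) auto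
  then have "a powr s * b powr t < a' powr s * b powr t" using ab by simp
  then have "ennreal (a powr s * b powr t) < ennreal (a' powr s * b powr t)"
    by (simp add: ennreal_less_iff)
  also have "\<dots> \<le> H (s *\<^sub>R x + t *\<^sub>R y)"
    using a' ab by (intro log_concave_ennrealD[OF H st]) auto
  finally show ?thesis .
qed

text \<open>Equality in the hypotheses is reached by scaling \<open>a\<close> and \<open>b\<close> with \<open>c < 1\<close> and letting \<open>c\<close> tend
  to \<open>1\<close>; since \<open>s + t = 1\<close>, the conclusion scales with \<open>c\<close> as well.\<close>

lemma log_concave_ennreal_le:
  assumes H: "log_concave_ennreal H" and st: "0 < s" "0 < t" "s + t = 1" and ab: "0 < a" "0 < b"
    "ennreal a \<le> H x" "ennreal b \<le> H y"
  shows "ennreal (a powr s * b powr t) \<le> H (s *\<^sub>R x + t *\<^sub>R y)"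
proof (cases "H (s *\<^sub>R x + t *\<^sub>R y)")
  case (real r)
  have "c * (a powr s * b powr t) \<le> r" if c: "0 < c" "c < 1" for c
  proof -
    have "ennreal (c * a) < H x" "ennreal (c * b) < H y"
      using c ab by (auto intro: less_le_trans[of _ "ennreal a"] less_le_trans[of _ "ennreal b"] simp: ennreal_less_iff)
    then have "ennreal ((c * a) powr s * (c * b) powr t) \<le> H (s *\<^sub>R x + t *\<^sub>R y)"
      using c ab by (intro log_concave_ennrealD[OF H st]) auto
    moreover have "(c * a) powr s * (c * b) powr t = c * (a powr s * b powr t)"
      using c ab st powr_add[of c s t] by (simp add: powr_mult)
    ultimately show ?thesis using real by (simp add: ennreal_le_iff)
  qed
  then have "a powr s * b powr t \<le> r" by (rule field_le_mult_one_interval)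
  then show ?thesis using real by (simp add: ennreal_leI)
qed simp

lemma log_concave_ennreal_convex_superlevel:
  assumes H: "log_concave_ennreal H" and l: "0 < l"
  shows "convex {x. ennreal l < H x}"
proof (rule convexI)
  fix x y u v assume *: "x \<in> {x. ennreal l < H x}" "y \<in> {x. ennreal l < H x}" "0 \<le> u" "0 \<le> v" "(u::real) + v = 1"
  show "u *\<^sub>R x + v *\<^sub>R y \<in> {x. ennreal l < H x}"
  proof (cases "u = 0 \<or> v = 0")
    case False
    then have "ennreal (l powr u * l powr v) < H (u *\<^sub>R x + v *\<^sub>R y)"
      using * l by (intro log_concave_ennreal_less[OF H]) auto
    moreover have "l powr u * l powr v = l" using l * powr_add[of l u v] by simp
    ultimately show ?thesis by simp
  qed (use * in auto)
qed

lemma log_concave_ennreal_affine: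
  assumes H: "log_concave_ennreal H"
    and A: "\<And>x y s t. 0 < s \<Longrightarrow> 0 < t \<Longrightarrow> s + t = 1 \<Longrightarrow> A (s *\<^sub>R x + t *\<^sub>R y) = s *\<^sub>R A x + t *\<^sub>R A y"
  shows "log_concave_ennreal (\<lambda>x. H (A x))"
  unfolding log_concave_ennreal_def using A log_concave_ennrealD[OF H] by auto

lemma log_concave_ennreal_SUP:
  assumes H: "\<And>n::nat. log_concave_ennreal (H n)" and mono: "\<And>x. incseq (\<lambda>n. H n x)"
  shows "log_concave_ennreal (\<lambda>x. SUP n. H n x)"
  unfolding log_concave_ennreal_def
proof (intro allI impI)
  fix x y s t a b
  assume st: "0 < s" "0 < t" "(s::real) + t = 1" and ab: "0 < a" "0 < b" "ennreal a < (SUP n. H n x)" "ennreal b < (SUP n. H n y)"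
  obtain m n where mn: "ennreal a < H m x" "ennreal b < H n y" using ab by (auto simp: less_SUP_iff)
  have "ennreal a < H (max m n) x" "ennreal b < H (max m n) y"
    using mn incseqD[OF mono, of m "max m n" x] incseqD[OF mono, of n "max m n" y] by (auto intro: less_le_trans)
  then have "ennreal (a powr s * b powr t) \<le> H (max m n) (s *\<^sub>R x + t *\<^sub>R y)"
    using ab by (intro log_concave_ennrealD[OF H st])
  then show "ennreal (a powr s * b powr t) \<le> (SUP n. H n (s *\<^sub>R x + t *\<^sub>R y))"
    by (rule order_trans) (auto intro: SUP_upper)
qed

lemma log_concave_ennreal_of_fun:
  assumes f: "log_concave_fun f"
  shows "log_concave_ennreal (\<lambda>x. ennreal (f x))"
  unfolding log_concave_ennreal_def
proof (intro allI impI)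
  fix x y s t a b
  assume *: "0 < s" "0 < t" "(s::real) + t = 1" "0 < a" "0 < b" "ennreal a < ennreal (f x)" "ennreal b < ennreal (f y)"
  then have "a powr s * b powr t \<le> f x powr s * f y powr t"
    by (intro mult_mono powr_mono2) (auto simp: ennreal_less_iff)
  also have "\<dots> \<le> f (s *\<^sub>R x + t *\<^sub>R y)" using f * unfolding log_concave_fun_def by auto
  finally show "ennreal (a powr s * b powr t) \<le> ennreal (f (s *\<^sub>R x + t *\<^sub>R y))" by (rule ennreal_leI)
qed

lemma log_concave_fun_enn2real:
  fixes H :: "'a::euclidean_space \<Rightarrow> ennreal"
  assumes H: "log_concave_ennreal H" and fin: "\<And>x. H x < \<infinity>"
  shows "log_concave_fun (\<lambda>x. enn2real (H x))"
  unfolding log_concave_fun_def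
proof (intro conjI allI impI)
  fix x y :: 'a and s t :: real
  assume st: "0 \<le> s" "0 \<le> t" "s + t = 1"
  consider "s = 0" | "t = 0" | "enn2real (H x) = 0" | "enn2real (H y) = 0"
    | "0 < s" "0 < t" "0 < enn2real (H x)" "0 < enn2real (H y)"
    using st by (metis enn2real_nonneg less_eq_real_def)
  then show "enn2real (H (s *\<^sub>R x + t *\<^sub>R y)) \<ge> enn2real (H x) powr s * enn2real (H y) powr t"
  proof cases
    case 5
    then have "ennreal (enn2real (H x) powr s * enn2real (H y) powr t) \<le> H (s *\<^sub>R x + t *\<^sub>R y)"
      using st fin by (intro log_concave_ennreal_le[OF H]) (auto simp: less_top)
    then show ?thesis using fin[of "s *\<^sub>R x + t *\<^sub>R y"]
      by (cases "H (s *\<^sub>R x + t *\<^sub>R y)") (auto simp: ennreal_le_iff)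
  qed (use st in \<open>auto simp: powr_def less_le\<close>)
qed auto

text \<open>The restrictions of \<open>H\<close> to the parallel lines through \<open>x\<close>, \<open>y\<close> and \<open>s x + t y\<close> satisfy the
  hypotheses of the one-dimensional inequality.\<close>

lemma log_concave_ennreal_integral_line:
  fixes H :: "'a::real_normed_vector \<Rightarrow> ennreal"
  assumes H: "log_concave_ennreal H" and [measurable]: "H \<in> borel_measurable borel"
  shows "log_concave_ennreal (\<lambda>x. \<integral>\<^sup>+u. H (x + u *\<^sub>R v) \<partial>lborel)"
  unfolding log_concave_ennreal_def
proof (intro allI impI)
  fix x y s t a b
  assume st: "0 < s" "0 < t" "(s::real) + t = 1" and ab: "0 < a" "0 < b"
    "ennreal a < (\<integral>\<^sup>+u. H (x + u *\<^sub>R v) \<partial>lborel)" "ennreal b < (\<integral>\<^sup>+u. H (y + u *\<^sub>R v) \<partial>lborel)"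
  have [measurable]: "(\<lambda>u::real. H (z + u *\<^sub>R v)) \<in> borel_measurable borel" for z
  proof -
    have [measurable]: "(\<lambda>u::real. z + u *\<^sub>R v) \<in> borel_measurable borel"
      by (intro borel_measurable_continuous_onI continuous_intros)
    show ?thesis by measurable
  qed
  show "ennreal (a powr s * b powr t) \<le> (\<integral>\<^sup>+w. H (s *\<^sub>R x + t *\<^sub>R y + w *\<^sub>R v) \<partial>lborel)"
  proof (rule Prekopa_Leindler_line[OF _ _ _ st _ _ ab])
    fix u u' c d
    assume "0 < c" "0 < d" "ennreal c < H (x + u *\<^sub>R v)" "ennreal d < H (y + u' *\<^sub>R v)"
    then have "ennreal (c powr s * d powr t) < H (s *\<^sub>R (x + u *\<^sub>R v) + t *\<^sub>R (y + u' *\<^sub>R v))"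
      by (intro log_concave_ennreal_less[OF H st])
    then show "ennreal (c powr s * d powr t) < H (s *\<^sub>R x + t *\<^sub>R y + (s * u + t * u') *\<^sub>R v)"
      by (simp add: algebra_simps)
  next
    fix l :: real assume "0 < l"
    have aff: "z + (p * u + q * u') *\<^sub>R v = p *\<^sub>R (z + u *\<^sub>R v) + q *\<^sub>R (z + u' *\<^sub>R v)" if "p + q = 1" for p q u u' z
    proof -
      have "z = (p + q) *\<^sub>R z" using that by simp
      then show ?thesis by (simp add: algebra_simps)
    qed
    have "log_concave_ennreal (\<lambda>w::real. H (s *\<^sub>R x + t *\<^sub>R y + w *\<^sub>R v))"
      by (rule log_concave_ennreal_affine[OF H]) (simp add: aff)
    then show "convex {w::real. ennreal l < H (s *\<^sub>R x + t *\<^sub>R y + w *\<^sub>R v)}"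
      using \<open>0 < l\<close> by (rule log_concave_ennreal_convex_superlevel)
  qed measurable
qed

text \<open>Integrating along one direction leaves a log-concave function on the same space, so the next
  direction can be integrated out in the same way. Formulating this with shifts by arbitrary vectors
  \<open>e i\<close> keeps the space fixed during the induction.\<close>

lemma log_concave_ennreal_integral_directions:
  fixes H :: "'a::{real_normed_vector, second_countable_topology} \<Rightarrow> ennreal" and e :: "'i \<Rightarrow> 'a"
  assumes "finite I" and H: "log_concave_ennreal H" and [measurable]: "H \<in> borel_measurable borel"
  shows "log_concave_ennreal (\<lambda>x. \<integral>\<^sup>+w. H (x + (\<Sum>i\<in>I. w i *\<^sub>R e i)) \<partial>Pi\<^sub>M I (\<lambda>_. lborel))"
  using \<open>finite I\<close>
proof induction
  case empty
  have "(\<integral>\<^sup>+w. H (x + (\<Sum>i\<in>{}. w i *\<^sub>R e i)) \<partial>Pi\<^sub>M {} (\<lambda>_. lborel :: real measure)) = H x" for x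
    by (simp add: PiM_empty nn_integral_count_space_finite)
  then show ?case using H by simp
next
  case (insert j I)
  interpret product_sigma_finite "\<lambda>_::'i. lborel :: real measure" ..
  interpret finite_product_sigma_finite "\<lambda>_::'i. lborel :: real measure" I
    by standard (use insert in auto)
  let ?G = "\<lambda>x. \<integral>\<^sup>+w. H (x + (\<Sum>i\<in>I. w i *\<^sub>R e i)) \<partial>Pi\<^sub>M I (\<lambda>_. lborel)"
  have [measurable]: "?G \<in> borel_measurable borel" by measurable
  have "(\<integral>\<^sup>+w. H (x + (\<Sum>i\<in>insert j I. w i *\<^sub>R e i)) \<partial>Pi\<^sub>M (insert j I) (\<lambda>_. lborel))
      = (\<integral>\<^sup>+u. ?G (x + u *\<^sub>R e j) \<partial>lborel)" for x
  proof -
    have "(\<integral>\<^sup>+w. H (x + (\<Sum>i\<in>insert j I. w i *\<^sub>R e i)) \<partial>Pi\<^sub>M (insert j I) (\<lambda>_. lborel))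
      = (\<integral>\<^sup>+u. (\<integral>\<^sup>+w. H (x + (\<Sum>i\<in>insert j I. (w(j := u)) i *\<^sub>R e i)) \<partial>Pi\<^sub>M I (\<lambda>_. lborel)) \<partial>lborel)"
      using insert by (intro product_nn_integral_insert_rev) auto
    also have "\<dots> = (\<integral>\<^sup>+u. ?G (x + u *\<^sub>R e j) \<partial>lborel)"
    proof (intro nn_integral_cong)
      fix u :: real and w :: "'i \<Rightarrow> real"
      have "(\<Sum>i\<in>I. (w(j := u)) i *\<^sub>R e i) = (\<Sum>i\<in>I. w i *\<^sub>R e i)"
        using insert by (intro sum.cong) auto
      then show "H (x + (\<Sum>i\<in>insert j I. (w(j := u)) i *\<^sub>R e i)) = H (x + u *\<^sub>R e j + (\<Sum>i\<in>I. w i *\<^sub>R e i))"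
        using insert by (simp add: add.assoc)
    qed
    finally show ?thesis .
  qed
  moreover have "log_concave_ennreal (\<lambda>x. \<integral>\<^sup>+u. ?G (x + u *\<^sub>R e j) \<partial>lborel)"
    by (rule log_concave_ennreal_integral_line[OF insert.IH]) measurable
  ultimately show ?case by simp
qed

text \<open>The integral over the second factor runs through the directions \<open>(0, i)\<close> with \<open>i\<close> in the basis.\<close>

theorem Prekopa:
  fixes H :: "'a::euclidean_space \<times> 'b::euclidean_space \<Rightarrow> ennreal"
  assumes H: "log_concave_ennreal H" and [measurable]: "H \<in> borel_measurable borel"
  shows "log_concave_ennreal (\<lambda>x. \<integral>\<^sup>+y. H (x, y) \<partial>lborel)"
proof -
  have m: "(\<lambda>y. H (x, y)) \<in> borel_measurable borel" for x
  proof -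
    have [measurable]: "Pair x \<in> (borel :: 'b measure) \<rightarrow>\<^sub>M (borel :: ('a \<times> 'b) measure)"
      by (intro borel_measurable_continuous_onI continuous_intros)
    show ?thesis by measurable
  qed
  have "(\<integral>\<^sup>+y. H (x, y) \<partial>lborel)
      = (\<integral>\<^sup>+w. H ((x, 0) + (\<Sum>i\<in>Basis. w i *\<^sub>R (0, i))) \<partial>Pi\<^sub>M Basis (\<lambda>_. lborel))" for x
  proof -
    have pair: "(x, \<Sum>i\<in>Basis. w i *\<^sub>R i) = (x, 0) + (\<Sum>i\<in>Basis. w i *\<^sub>R (0, i))" for w :: "'b \<Rightarrow> real"
      by (intro prod_eqI) (auto simp: fst_sum snd_sum)
    show ?thesis
      by (subst lborel_eq, subst nn_integral_distr) (use m in \<open>auto simp: pair\<close>)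
  qed
  moreover have "log_concave_ennreal (\<lambda>x. \<integral>\<^sup>+w. H ((x, 0) + (\<Sum>i\<in>Basis. w i *\<^sub>R (0, i))) \<partial>Pi\<^sub>M Basis (\<lambda>_. lborel))"
    by (rule log_concave_ennreal_affine[OF log_concave_ennreal_integral_directions[OF _ H]]) auto
  ultimately show ?thesis by simp
qed

section \<open>Convolution of a log-concave measure with test functions\<close>

text \<open>Balls are not null sets.\<close>

lemma AE_lborel_arbitrarily_close:
  fixes x :: "'a::euclidean_space"
  assumes "AE z in lborel. P z" and "0 < r"
  shows "\<exists>z\<in>ball x r. P z"
proof (rule ccontr)
  assume "\<not> ?thesis"
  then have "AE z in lborel. z \<notin> ball x r" using assms(1) by (rule_tac AE_mp) auto
  then have "emeasure lborel (ball x r) = 0"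
    by (subst (asm) AE_iff_measurable[of "ball x r"]) auto
  then show False using content_ball_pos[OF \<open>0 < r\<close>, of x]
    by (simp add: measure_def)
qed

lemma radon_measure_sets: "radon_measure \<nu> \<Longrightarrow> sets \<nu> = sets borel"
  by (simp add: radon_measure_def)

lemma radon_measure_space: "radon_measure \<nu> \<Longrightarrow> space \<nu> = UNIV"
  using sets_eq_imp_space_eq[OF radon_measure_sets] by simp

lemma radon_measure_cball_finite: "radon_measure \<nu> \<Longrightarrow> emeasure \<nu> (cball x r) < \<infinity>"
  by (simp add: radon_measure_def)

lemma radon_measure_sigma_finite:
  fixes \<nu> :: "'a::euclidean_space measure"
  assumes "radon_measure \<nu>"
  shows "sigma_finite_measure \<nu>"
proof
  have "(\<Union>n::nat. cball (0::'a) (real n)) = UNIV"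
    using real_arch_simple by auto
  then show "\<exists>A. countable A \<and> A \<subseteq> sets \<nu> \<and> \<Union> A = space \<nu> \<and> (\<forall>a\<in>A. emeasure \<nu> a \<noteq> \<infinity>)"
    using assms radon_measure_cball_finite[OF assms]
    by (intro exI[of _ "range (\<lambda>n::nat. cball 0 (real n))"])
      (auto simp: radon_measure_sets radon_measure_space less_top)
qed

lemma radon_measure_density:
  fixes f :: "'a::euclidean_space \<Rightarrow> ennreal"
  assumes [measurable]: "f \<in> borel_measurable borel"
    and bound: "\<And>r. \<exists>M. \<forall>x. norm x \<le> r \<longrightarrow> f x \<le> ennreal M"
  shows "radon_measure (density lborel f)"
  unfolding radon_measure_def
proof (intro conjI allI impI)
  fix K :: "'a set" assume K: "compact K"
  then obtain r where r: "\<And>x. x \<in> K \<Longrightarrow> norm x \<le> r" using compact_imp_bounded bounded_iff by metis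
  obtain M where M: "\<And>x. norm x \<le> r \<Longrightarrow> f x \<le> ennreal M" using bound by blast
  have [measurable]: "K \<in> sets borel" using K by (simp add: borel_compact)
  have "emeasure (density lborel f) K = (\<integral>\<^sup>+x. f x * indicator K x \<partial>lborel)"
    by (simp add: emeasure_density)
  also have "\<dots> \<le> (\<integral>\<^sup>+x. ennreal M * indicator K x \<partial>lborel)"
    using M r by (intro nn_integral_mono) (auto simp: indicator_def)
  also have "\<dots> = ennreal M * emeasure lborel K" by (simp add: nn_integral_cmult)
  also have "\<dots> < \<infinity>"
    using emeasure_compact_finite[OF K] by (simp add: ennreal_mult_less_top)
  finally show "emeasure (density lborel f) K < \<infinity>" .
qed simp

abbreviation convolve :: "('a::euclidean_space \<Rightarrow> real) \<Rightarrow> 'a measure \<Rightarrow> 'a \<Rightarrow> ennreal" where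
  "convolve f \<nu> x \<equiv> \<integral>\<^sup>+ y. ennreal (f (x - y)) \<partial>\<nu>"

lemma measurable_convolve:
  assumes "radon_measure \<nu>" and [measurable]: "f \<in> borel_measurable borel"
  shows "convolve f \<nu> \<in> borel_measurable borel"
proof -
  interpret sigma_finite_measure \<nu> by (rule radon_measure_sigma_finite) fact
  note [measurable_cong] = radon_measure_sets[OF assms(1)]
  show ?thesis by measurable
qed

text \<open>The comparison with \<open>M\<close> times an indicator is the dominating function for all limits and finiteness
  statements about \<open>convolve \<theta> \<nu>\<close>.\<close>

lemma compact_support_bound:
  fixes \<theta> :: "'a::euclidean_space \<Rightarrow> real"
  assumes "continuous_on UNIV \<theta>" "compact (closure {x. \<theta> x \<noteq> 0})"
  obtains M r where "0 \<le> M" "0 \<le> r" "\<And>x. \<theta> x \<le> M * indicator (cball 0 r) x"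
proof -
  let ?K = "closure {x. \<theta> x \<noteq> 0}"
  have "bounded (\<theta> ` ?K)"
    using assms by (intro compact_imp_bounded compact_continuous_image) (auto intro: continuous_on_subset)
  then obtain M where M: "\<And>x. x \<in> ?K \<Longrightarrow> \<bar>\<theta> x\<bar> \<le> M" "0 < M" by (auto simp: bounded_pos)
  obtain r where r: "\<And>x. x \<in> ?K \<Longrightarrow> norm x \<le> r" "0 < r"
    using compact_imp_bounded[OF assms(2)] by (auto simp: bounded_pos)
  have "\<theta> x \<le> M * indicator (cball 0 r) x" for x
  proof (cases "\<theta> x = 0")
    case False
    then have "x \<in> ?K" using closure_subset[of "{x. \<theta> x \<noteq> 0}"] by auto
    then show ?thesis using M(1)[of x] r(1)[of x] by (auto simp: indicator_def)
  qed (use M in auto)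
  then show thesis using M r by (intro that[of M r]) auto
qed

text \<open>Along a convergent, hence bounded, sequence the integrands are dominated by a multiple of the
  indicator of one ball, which has finite measure.\<close>

lemma convolve_tendsto:
  fixes \<theta> :: "'a::euclidean_space \<Rightarrow> real"
  assumes \<nu>: "radon_measure \<nu>" and \<theta>: "continuous_on UNIV \<theta>" "compact (closure {x. \<theta> x \<noteq> 0})"
    and X: "X \<longlonglongrightarrow> x"
  shows "(\<lambda>n. convolve \<theta> \<nu> (X n)) \<longlonglongrightarrow> convolve \<theta> \<nu> x"
proof -
  note [measurable_cong] = radon_measure_sets[OF \<nu>]
  have [measurable]: "\<theta> \<in> borel_measurable borel" using \<theta> by (rule_tac borel_measurable_continuous_onI)
  obtain M r where M: "0 \<le> M" "0 \<le> r" "\<And>x. \<theta> x \<le> M * indicator (cball 0 r) x"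
    using compact_support_bound[OF \<theta>] by blast
  obtain B where B: "\<And>n. norm (X n) \<le> B"
    using convergent_imp_Bseq[of X] X by (auto simp: convergent_def Bseq_def)
  have [measurable]: "cball (0::'a) (B + r) \<in> sets borel" by simp
  show ?thesis
  proof (rule nn_integral_dominated_convergence[where w = "\<lambda>y. ennreal M * indicator (cball 0 (B + r)) y"])
    fix n
    have "ennreal (\<theta> (X n - y)) \<le> ennreal M * indicator (cball 0 (B + r)) y" for y
    proof (cases "norm (X n - y) \<le> r")
      case True
      then have "norm y \<le> B + r" using norm_triangle_ineq2[of y "X n"] B[of n] by (simp add: norm_minus_commute)
      then show ?thesis using M(3)[of "X n - y"] True by (simp add: ennreal_leI)
    next
      case False
      then show ?thesis using M(3)[of "X n - y"] by (simp add: ennreal_neg)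
    qed
    then show "AE y in \<nu>. ennreal (\<theta> (X n - y)) \<le> ennreal M * indicator (cball 0 (B + r)) y" by simp
  next
    show "(\<integral>\<^sup>+ y. ennreal M * indicator (cball 0 (B + r)) y \<partial>\<nu>) < \<infinity>"
      using radon_measure_cball_finite[OF \<nu>, of 0 "B + r"]
      by (simp add: nn_integral_cmult_indicator radon_measure_sets[OF \<nu>] ennreal_mult_less_top)
  next
    have "(\<lambda>n. \<theta> (X n - y)) \<longlonglongrightarrow> \<theta> (x - y)" for y
      using \<theta>(1) X by (intro continuous_on_tendsto_compose[OF \<theta>(1)] tendsto_intros) auto
    then show "AE y in \<nu>. (\<lambda>n. ennreal (\<theta> (X n - y))) \<longlonglongrightarrow> ennreal (\<theta> (x - y))"
      by (auto intro!: AE_I2)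
  qed measurable
qed

text \<open>The definition provides a log-concave density that agrees with \<open>convolve \<theta> \<nu>\<close> only almost everywhere.
  For almost every small \<open>e\<close> they agree at \<open>x + e\<close>, \<open>y + e\<close> and \<open>s x + t y + e\<close> at once, and these
  three points are again in the position \<open>s\<close>, \<open>t\<close>; letting \<open>e\<close> tend to \<open>0\<close> and using continuity of
  the convolution yields the inequality at \<open>x\<close>, \<open>y\<close> itself.\<close>

lemma convolve_log_concave:
  fixes \<theta> :: "'a::euclidean_space \<Rightarrow> real"
  assumes \<nu>: "log_concave_measure \<nu>"
    and \<theta>: "log_concave_fun \<theta>" "continuous_on UNIV \<theta>" "compact (closure {x. \<theta> x \<noteq> 0})"
  shows "log_concave_ennreal (convolve \<theta> \<nu>)"
proof -
  have rad: "radon_measure \<nu>" using \<nu> by (simp add: log_concave_measure_def)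
  have [measurable]: "\<theta> \<in> borel_measurable borel" using \<theta> by (rule_tac borel_measurable_continuous_onI)
  let ?\<Phi> = "convolve \<theta> \<nu>"
  have [measurable]: "?\<Phi> \<in> borel_measurable borel" by (rule measurable_convolve[OF rad]) measurable
  obtain g where [measurable]: "g \<in> borel_measurable borel" and g: "log_concave_fun g"
      "density lborel ?\<Phi> = density lborel (\<lambda>x. ennreal (g x))"
    using \<nu> \<theta> unfolding log_concave_measure_def has_log_concave_density_def conv_measure_def by blast
  have "AE z in lborel. ?\<Phi> z = ennreal (g z)"
    by (intro sigma_finite_measure.density_unique[OF sigma_finite_lborel] g) measurable
  then have shift: "AE e in lborel. ?\<Phi> (x + e) = ennreal (g (x + e))" for x
    by (intro AE_distrD[of "(+) x" lborel borel "\<lambda>z. ?\<Phi> z = ennreal (g z)"]) (simp, unfold lborel_distr_plus)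
  show ?thesis
    unfolding log_concave_ennreal_def
  proof (intro allI impI)
    fix x y s t a b
    assume st: "0 < s" "0 < t" "(s::real) + t = 1" and ab: "0 < a" "0 < b" "ennreal a < ?\<Phi> x" "ennreal b < ?\<Phi> y"
    define z where "z = s *\<^sub>R x + t *\<^sub>R y"
    have "AE e in lborel. ?\<Phi> (x + e) = ennreal (g (x + e)) \<and> ?\<Phi> (y + e) = ennreal (g (y + e))
        \<and> ?\<Phi> (z + e) = ennreal (g (z + e))"
      using shift by (intro AE_conjI)
    from AE_lborel_arbitrarily_close[OF this]
    have "\<exists>e. norm e < 1 / real (Suc n) \<and> ?\<Phi> (x + e) = ennreal (g (x + e)) \<and> ?\<Phi> (y + e) = ennreal (g (y + e))
        \<and> ?\<Phi> (z + e) = ennreal (g (z + e))" for n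
      by (metis mem_ball_0 of_nat_0_less_iff zero_less_Suc zero_less_divide_1_iff)
    then obtain e where e: "\<And>n. norm (e n) < 1 / real (Suc n)"
      and eq: "\<And>n. ?\<Phi> (x + e n) = ennreal (g (x + e n))" "\<And>n. ?\<Phi> (y + e n) = ennreal (g (y + e n))"
        "\<And>n. ?\<Phi> (z + e n) = ennreal (g (z + e n))"
      by metis
    have "(\<lambda>n. 1 / real (Suc n)) \<longlonglongrightarrow> 0" by (rule LIMSEQ_Suc[OF lim_1_over_n])
    then have e0: "e \<longlonglongrightarrow> 0"
      using e by (intro Lim_null_comparison[of e]) (auto intro: less_imp_le eventuallyI)
    have lim: "(\<lambda>n. ?\<Phi> (w + e n)) \<longlonglongrightarrow> ?\<Phi> w" for w
      using tendsto_add[OF tendsto_const[of w] e0] by (intro convolve_tendsto[OF rad \<theta>(2,3)]) simp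
    have "\<forall>\<^sub>F n in sequentially. ennreal a < ?\<Phi> (x + e n)" "\<forall>\<^sub>F n in sequentially. ennreal b < ?\<Phi> (y + e n)"
      using order_tendstoD(1)[OF lim] ab by auto
    then have "\<forall>\<^sub>F n in sequentially. ennreal (a powr s * b powr t) \<le> ?\<Phi> (z + e n)"
    proof eventually_elim
      case (elim n)
      have split: "z + e n = s *\<^sub>R (x + e n) + t *\<^sub>R (y + e n)"
        using st by (simp add: z_def scaleR_add_right algebra_simps flip: scaleR_add_left)
      have "ennreal (a powr s * b powr t) \<le> ennreal (g (s *\<^sub>R (x + e n) + t *\<^sub>R (y + e n)))"
        using elim ab unfolding eq
        by (intro log_concave_ennrealD[OF log_concave_ennreal_of_fun[OF g(1)] st]) auto
      then show ?case unfolding split[symmetric] eq(3) .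
    qed
    then show "ennreal (a powr s * b powr t) \<le> ?\<Phi> (s *\<^sub>R x + t *\<^sub>R y)"
      using lim[of z] unfolding z_def[symmetric] by (intro tendsto_lowerbound) auto
  qed
qed

section \<open>Gaussians and tents\<close>

lemma log_concave_fun_mult:
  assumes "log_concave_fun f" "log_concave_fun g"
  shows "log_concave_fun (\<lambda>x. f x * g x)"
  unfolding log_concave_fun_def
proof (intro conjI allI impI)
  fix x y and s t :: real assume st: "0 \<le> s" "0 \<le> t" "s + t = 1"
  have nn: "0 \<le> f x" "0 \<le> g x" for x using assms by (auto simp: log_concave_fun_def)
  have "(f x * g x) powr s * (f y * g y) powr t = (f x powr s * f y powr t) * (g x powr s * g y powr t)"
    using nn by (simp add: powr_mult)
  also have "\<dots> \<le> f (s *\<^sub>R x + t *\<^sub>R y) * g (s *\<^sub>R x + t *\<^sub>R y)"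
    using assms st nn by (intro mult_mono) (auto simp: log_concave_fun_def)
  finally show "(f x * g x) powr s * (f y * g y) powr t \<le> f (s *\<^sub>R x + t *\<^sub>R y) * g (s *\<^sub>R x + t *\<^sub>R y)" .
qed (use assms in \<open>auto simp: log_concave_fun_def\<close>)

lemma log_concave_fun_affine:
  assumes "log_concave_fun f"
    and A: "\<And>x y s t. s + t = 1 \<Longrightarrow> A (s *\<^sub>R x + t *\<^sub>R y) = s *\<^sub>R A x + t *\<^sub>R A y"
  shows "log_concave_fun (\<lambda>x. f (A x))"
  using assms unfolding log_concave_fun_def by auto

text \<open>The parameter is the rate of decay and not a variance: rates add up in products, and the rate \<open>0\<close>
  is meaningful.\<close>

definition gaussian :: "real \<Rightarrow> 'a::euclidean_space \<Rightarrow> real" where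
  "gaussian c x = exp (- (c * (norm x)\<^sup>2))"

lemma continuous_gaussian [continuous_intros]:
  "continuous_on S f \<Longrightarrow> continuous_on S (\<lambda>x. gaussian c (f x))"
  unfolding gaussian_def by (intro continuous_intros)

lemma measurable_gaussian [measurable]: "gaussian c \<in> borel_measurable borel"
  by (intro borel_measurable_continuous_onI continuous_intros)

lemma log_concave_gaussian:
  assumes "0 \<le> c"
  shows "log_concave_fun (gaussian c)"
  unfolding log_concave_fun_def
proof (intro conjI allI impI)
  fix x y :: 'a and s t :: real assume st: "0 \<le> s" "0 \<le> t" "s + t = 1"
  have "norm (s *\<^sub>R x + t *\<^sub>R y) \<le> s * norm x + t * norm y"
    using norm_triangle_ineq[of "s *\<^sub>R x" "t *\<^sub>R y"] st by simp
  then have "(norm (s *\<^sub>R x + t *\<^sub>R y))\<^sup>2 \<le> (s * norm x + t * norm y)\<^sup>2" by (intro power_mono) auto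
  also have "\<dots> \<le> s * (norm x)\<^sup>2 + t * (norm y)\<^sup>2"
  proof -
    have t: "t = 1 - s" using st by simp
    have "s * (norm x)\<^sup>2 + t * (norm y)\<^sup>2 - (s * norm x + t * norm y)\<^sup>2 = s * t * (norm x - norm y)\<^sup>2"
      unfolding t by algebra
    also have "\<dots> \<ge> 0" using st by simp
    finally show ?thesis by simp
  qed
  finally have "c * (norm (s *\<^sub>R x + t *\<^sub>R y))\<^sup>2 \<le> c * (s * (norm x)\<^sup>2 + t * (norm y)\<^sup>2)"
    using assms by (rule mult_left_mono)
  then show "gaussian c x powr s * gaussian c y powr t \<le> gaussian c (s *\<^sub>R x + t *\<^sub>R y)"
    by (simp add: gaussian_def powr_def algebra_simps flip: exp_add)
qed (simp add: gaussian_def)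

text \<open>The standard example of a continuous log-concave function with compact support: it cuts off other
  log-concave functions, and it increases to \<open>1\<close> as \<open>r\<close> grows.\<close>

definition tent :: "real \<Rightarrow> 'a::euclidean_space \<Rightarrow> real" where
  "tent r x = max 0 (1 - norm x / r)"

lemma continuous_tent: "0 < r \<Longrightarrow> continuous_on S (tent r)"
  unfolding tent_def by (intro continuous_intros) auto

text \<open>The factor \<open>k\<close> is there for tents that multiply a Gaussian.\<close>

lemma tent_support:
  assumes "0 < r" and f: "\<And>x. f x = tent r x * k x"
  shows "compact (closure {x::'a::euclidean_space. f x \<noteq> 0})"
proof -
  have "{x::'a. f x \<noteq> 0} \<subseteq> cball 0 r"
    using assms by (auto simp: tent_def max_def field_simps split: if_splits)
  then show ?thesis using bounded_cball bounded_subset by (auto simp: compact_closure)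
qed

text \<open>Where both values are positive, the tent is concave there, and the arithmetic-geometric inequality
  turns concavity into log-concavity.\<close>

lemma log_concave_tent:
  assumes "0 < r"
  shows "log_concave_fun (tent r)"
  unfolding log_concave_fun_def
proof (intro conjI allI impI)
  fix x y :: 'a and s t :: real assume st: "0 \<le> s" "0 \<le> t" "s + t = 1"
  show "tent r x powr s * tent r y powr t \<le> tent r (s *\<^sub>R x + t *\<^sub>R y)"
  proof (cases "0 < 1 - norm x / r \<and> 0 < 1 - norm y / r")
    case True
    then have "tent r x powr s * tent r y powr t \<le> s * (1 - norm x / r) + t * (1 - norm y / r)"
      using st unfolding tent_def by (simp add: max_def) (intro Youngs_inequality_0, auto)
    also have "\<dots> = 1 - (s * norm x + t * norm y) / r"
      using st by (simp add: algebra_simps add_divide_distrib)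
    also have "\<dots> \<le> 1 - norm (s *\<^sub>R x + t *\<^sub>R y) / r"
      using norm_triangle_ineq[of "s *\<^sub>R x" "t *\<^sub>R y"] st assms by (simp add: divide_right_mono)
    finally show ?thesis by (simp add: tent_def)
  next
    case False
    then have "tent r x = 0 \<or> tent r y = 0" by (auto simp: tent_def)
    then show ?thesis by (auto simp: tent_def)
  qed
qed (simp add: tent_def)

text \<open>The definition of a log-concave measure only tests compactly supported functions; a Gaussian is the
  increasing limit of its products with wider and wider tents. The value \<open>\<infinity>\<close> is not excluded at
  this stage.\<close>

lemma convolve_gaussian_log_concave:
  fixes \<nu> :: "'a::euclidean_space measure"
  assumes \<nu>: "log_concave_measure \<nu>" and c: "0 \<le> c"
  shows "log_concave_ennreal (convolve (gaussian c) \<nu>)"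
proof -
  have rad: "radon_measure \<nu>" using \<nu> by (simp add: log_concave_measure_def)
  note [measurable_cong] = radon_measure_sets[OF rad]
  let ?\<theta> = "\<lambda>n (x::'a). tent (real (Suc n)) x * gaussian c x"
  have [measurable]: "?\<theta> n \<in> borel_measurable borel" for n
    by (intro borel_measurable_continuous_onI continuous_intros continuous_tent) auto
  have "tent (real (Suc m)) u \<le> tent (real (Suc n)) u" if "m \<le> n" for m n and u :: 'a
    unfolding tent_def using that by (intro max.mono diff_left_mono divide_left_mono) auto
  then have inc: "incseq (\<lambda>n. ennreal (?\<theta> n u))" for u
    unfolding incseq_def by (intro allI impI ennreal_leI mult_right_mono) (auto simp: gaussian_def)
  have "(\<lambda>n. ?\<theta> n u) \<longlonglongrightarrow> gaussian c u" for u
  proof -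
    have "(\<lambda>n. norm u / real (Suc n)) \<longlonglongrightarrow> 0"
      using LIMSEQ_Suc[OF lim_const_over_n[of "norm u"]] by simp
    then have "(\<lambda>n. max 0 (1 - norm u / real (Suc n)) * gaussian c u) \<longlonglongrightarrow> max 0 (1 - 0) * gaussian c u"
      by (intro tendsto_intros)
    then show ?thesis by (simp add: tent_def)
  qed
  then have "(SUP n. ennreal (?\<theta> n u)) = ennreal (gaussian c u)" for u
    by (intro LIMSEQ_unique[OF LIMSEQ_SUP[OF inc]]) (simp add: tendsto_ennrealI)
  then have "convolve (gaussian c) \<nu> x = (\<integral>\<^sup>+ y. (SUP n. ennreal (?\<theta> n (x - y))) \<partial>\<nu>)" for x
    by simp
  also have "\<dots> x = (SUP n. convolve (?\<theta> n) \<nu> x)" for x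
  proof (rule nn_integral_monotone_convergence_SUP)
    show "incseq (\<lambda>n y. ennreal (?\<theta> n (x - y)))" using inc by (auto simp: incseq_def le_fun_def)
  qed measurable
  finally have "convolve (gaussian c) \<nu> = (\<lambda>x. SUP n. convolve (?\<theta> n) \<nu> x)" by blast
  moreover have "log_concave_ennreal (\<lambda>x. SUP n. convolve (?\<theta> n) \<nu> x)"
  proof (rule log_concave_ennreal_SUP)
    show "log_concave_ennreal (convolve (?\<theta> n) \<nu>)" for n
    proof (rule convolve_log_concave[OF \<nu>])
      show "log_concave_fun (?\<theta> n)"
        using c by (intro log_concave_fun_mult log_concave_tent log_concave_gaussian) auto
      show "continuous_on UNIV (?\<theta> n)" by (intro continuous_intros continuous_tent) auto
      show "compact (closure {x. ?\<theta> n x \<noteq> 0})" by (rule tent_support[of "real (Suc n)"]) auto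
    qed
    show "incseq (\<lambda>n. convolve (?\<theta> n) \<nu> x)" for x
      using inc by (auto simp: incseq_def intro!: nn_integral_mono)
  qed
  ultimately show ?thesis by simp
qed

section \<open>Gaussian integrals against log-concave measures\<close>

lemma gaussian_integral_finite:
  assumes c: "0 < c"
  shows "(\<integral>\<^sup>+x. ennreal (gaussian c (x::'a::euclidean_space)) \<partial>lborel) < \<infinity>"
proof -
  \<comment> \<open>The deviation for which the normal density is proportional to the Gaussian of rate \<open>c\<close>.\<close>
  define \<tau> where "\<tau> = sqrt (1 / (2 * c))"
  have \<tau>: "0 < \<tau>" "2 * \<tau>\<^sup>2 = 1 / c" using c by (simp_all add: \<tau>_def)
  have line: "(\<integral>\<^sup>+u. ennreal (exp (- (c * u\<^sup>2))) \<partial>lborel) < \<infinity>"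
  proof -
    have "exp (- (c * u\<^sup>2)) = sqrt (2 * pi * \<tau>\<^sup>2) * normal_density 0 \<tau> u" for u
    proof -
      have "- u\<^sup>2 / (2 * \<tau>\<^sup>2) = - (c * u\<^sup>2)" using \<tau> by simp
      then show ?thesis using \<tau> by (simp add: normal_density_def)
    qed
    then have "integrable lborel (\<lambda>u. exp (- (c * u\<^sup>2)))"
      using integrable_normal_moment[OF \<tau>(1), of 0 0] by simp
    then show ?thesis by (simp add: integrable_iff_bounded)
  qed
  have "gaussian c x = (\<Prod>b\<in>Basis. exp (- (c * (x \<bullet> b)\<^sup>2)))" for x :: 'a
  proof -
    have "(norm x)\<^sup>2 = (\<Sum>b\<in>Basis. (x \<bullet> b)\<^sup>2)"
      by (subst power2_norm_eq_inner, subst euclidean_inner) (simp add: power2_eq_square)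
    then show ?thesis by (simp add: gaussian_def sum_distrib_left sum_negf flip: exp_sum)
  qed
  then have "(\<integral>\<^sup>+x. ennreal (gaussian c (x::'a)) \<partial>lborel)
      = (\<integral>\<^sup>+x. (\<Prod>b\<in>(Basis::'a set). ennreal (exp (- (c * (x \<bullet> b)\<^sup>2)))) \<partial>lborel)"
    by (simp add: prod_ennreal)
  also have "\<dots> = (\<Prod>b\<in>(Basis::'a set). \<integral>\<^sup>+u. ennreal (exp (- (c * u\<^sup>2))) \<partial>lborel)"
    by (rule nn_integral_lborel_prod) auto
  also have "\<dots> < \<infinity>"
    using line by (simp add: power_less_top_ennreal)
  finally show ?thesis .
qed

text \<open>Fix \<open>y\<close> with \<open>G y > 0\<close>. A large value of \<open>G\<close> at a point \<open>w\<close> at distance \<open>R > 1\<close> from \<open>y\<close> forces a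
  large value at the point \<open>q\<close> of the segment at distance \<open>1\<close> from \<open>y\<close>, where \<open>G\<close> is bounded by \<open>M\<close>:
  \<open>G(y)\<^bsup>1 - 1/R\<^esup> G(w)\<^bsup>1/R\<^esup> \<le> M\<close>. Solved for \<open>G w\<close> this is an exponential bound with rate
  \<open>B = ln (M / G y)\<close>.\<close>

lemma log_concave_exponential_growth:
  fixes G :: "'a::euclidean_space \<Rightarrow> ennreal"
  assumes G: "log_concave_ennreal G" and fin: "\<And>x. G x < \<infinity>"
    and bound: "\<And>y. \<exists>M. \<forall>x\<in>cball y 1. G x \<le> ennreal M"
  shows "\<exists>A B. 0 \<le> A \<and> 0 \<le> B \<and> (\<forall>w. G w \<le> ennreal (A * exp (B * norm w)))"
proof (cases "\<forall>w. G w = 0")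
  case True
  then show ?thesis by (intro exI[of _ 0]) auto
next
  case False
  then obtain y where y: "G y \<noteq> 0" by auto
  define g where "g w = enn2real (G w)" for w
  have G_g: "G w = ennreal (g w)" "0 \<le> g w" for w using fin[of w] by (auto simp: g_def less_top)
  have gy: "0 < g y" using y G_g[of y] by (cases "g y = 0") auto
  obtain M' where M': "\<forall>x\<in>cball y 1. G x \<le> ennreal M'" using bound by blast
  define M where "M = max M' (g y)"
  have M: "g x \<le> M" if "x \<in> cball y 1" for x
  proof (cases "0 \<le> M'")
    case True
    then have "g x \<le> M'" using bspec[OF M' that] G_g[of x] by (simp add: ennreal_le_iff)
    then show ?thesis by (simp add: M_def)
  next
    case False
    then have "g x = 0" using bspec[OF M' that] G_g[of x] by (simp add: ennreal_neg)
    then show ?thesis using gy by (simp add: M_def)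
  qed
  have "0 < M" using gy by (simp add: M_def)
  define B where "B = ln M - ln (g y)"
  have "0 \<le> B" using gy by (simp add: B_def M_def ln_mono)
  have far: "g w \<le> M * exp (B * norm (w - y))" for w
  proof (cases "norm (w - y) \<le> 1")
    case True
    then have "g w \<le> M" by (intro M) (simp add: dist_norm norm_minus_commute)
    also have "\<dots> \<le> M * exp (B * norm (w - y))" using \<open>0 < M\<close> \<open>0 \<le> B\<close> by simp
    finally show ?thesis .
  next
    case False
    define R where "R = norm (w - y)"
    have R: "1 < R" using False by (simp add: R_def)
    show ?thesis
    proof (cases "g w = 0")
      case False
      then have gw: "0 < g w" using G_g(2)[of w] by simp
      define q where "q = (1 - 1 / R) *\<^sub>R y + (1 / R) *\<^sub>R w"
      have "q - y = (1 / R) *\<^sub>R (w - y)" by (simp add: q_def algebra_simps)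
      then have "norm (q - y) = 1" using R by (auto simp: R_def)
      then have "g q \<le> M" by (intro M) (simp add: dist_norm norm_minus_commute)
      moreover have "ennreal (g y powr (1 - 1 / R) * g w powr (1 / R)) \<le> G q"
        unfolding q_def using gw gy R G_g by (intro log_concave_ennreal_le[OF G]) auto
      ultimately have "g y powr (1 - 1 / R) * g w powr (1 / R) \<le> M"
        using G_g[of q] by (simp add: ennreal_le_iff)
      then have "ln (g y powr (1 - 1 / R) * g w powr (1 / R)) \<le> ln M"
        using gw gy by (intro ln_mono) auto
      then have "(1 - 1 / R) * ln (g y) + (1 / R) * ln (g w) \<le> ln M"
        using gw gy by (simp add: ln_mult ln_powr)
      then have "R * ((1 - 1 / R) * ln (g y) + (1 / R) * ln (g w)) \<le> R * ln M"
        using R by (intro mult_left_mono) auto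
      then have "(R - 1) * ln (g y) + ln (g w) \<le> R * ln M"
        using R by (simp add: algebra_simps)
      then have "ln (g w) \<le> ln M + B * R"
        using \<open>0 \<le> B\<close> by (simp add: B_def algebra_simps)
      then have "exp (ln (g w)) \<le> exp (ln M + B * R)" by simp
      then show ?thesis using gw \<open>0 < M\<close> by (simp add: exp_add R_def)
    qed (use \<open>0 < M\<close> in simp)
  qed
  have "G w \<le> ennreal (M * exp (B * norm y) * exp (B * norm w))" for w
  proof -
    have "B * norm (w - y) \<le> B * norm y + B * norm w"
      using mult_left_mono[OF norm_triangle_ineq4[of w y] \<open>0 \<le> B\<close>] by (simp add: algebra_simps)
    then have "M * exp (B * norm (w - y)) \<le> M * exp (B * norm y + B * norm w)"
      using \<open>0 < M\<close> by simp
    then show ?thesis using far[of w] G_g(1)[of w] by (auto intro!: ennreal_leI simp: exp_add mult.assoc)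
  qed
  then show ?thesis using \<open>0 < M\<close> \<open>0 \<le> B\<close>
    by (intro exI[of _ "M * exp (B * norm y)"] exI[of _ B]) auto
qed

text \<open>The Gaussian of rate \<open>c\<close> is dominated by the convolution of the Gaussian of rate \<open>c / 2\<close> with a tent.
  After an exchange of integrals the tent smooths \<open>\<nu>\<close> instead, and \<open>convolve (tent 2) \<nu>\<close> grows at most
  exponentially, which a Gaussian beats.\<close>

lemma log_concave_measure_gaussian_integral_finite:
  fixes \<nu> :: "'a::euclidean_space measure"
  assumes \<nu>: "log_concave_measure \<nu>" and c: "0 < c"
  shows "(\<integral>\<^sup>+y. ennreal (gaussian c y) \<partial>\<nu>) < \<infinity>"
proof -
  have rad: "radon_measure \<nu>" using \<nu> by (simp add: log_concave_measure_def)
  note [measurable_cong] = radon_measure_sets[OF rad]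
  interpret N: sigma_finite_measure \<nu> by (rule radon_measure_sigma_finite[OF rad])
  interpret P: pair_sigma_finite "lborel :: 'a measure" \<nu> ..
  let ?G = "convolve (tent 2) \<nu>"
  have [measurable]: "tent 2 \<in> borel_measurable (borel :: 'a measure)"
    by (intro borel_measurable_continuous_onI continuous_tent) auto
  have [measurable]: "cball (0::'a) r \<in> sets borel" for r by simp
  \<comment> \<open>The tent around a point of the unit ball about \<open>y\<close> lives on the ball of radius \<open>1 + 2\<close>.\<close>
  have near: "?G x \<le> emeasure \<nu> (cball y 3)" if "x \<in> cball y 1" for x y
  proof -
    have "?G x \<le> (\<integral>\<^sup>+z. indicator (cball y 3) z \<partial>\<nu>)"
    proof (intro nn_integral_mono)
      fix z
      show "ennreal (tent 2 (x - z)) \<le> indicator (cball y 3) z"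
      proof (cases "z \<in> cball y 3")
        case False
        then have "2 \<le> norm (x - z)"
          using that dist_triangle[of y z x] by (simp add: dist_norm)
        then show ?thesis by (simp add: tent_def)
      qed (simp add: tent_def)
    qed
    then show ?thesis by (simp add: radon_measure_sets[OF rad])
  qed
  have near': "\<exists>M. \<forall>x\<in>cball y 1. ?G x \<le> ennreal M" for y
    using near[of _ y] radon_measure_cball_finite[OF rad, of y 3]
    by (intro exI[of _ "enn2real (emeasure \<nu> (cball y 3))"]) (auto simp: less_top)
  obtain A B where AB: "0 \<le> A" "0 \<le> B" "\<And>w. ?G w \<le> ennreal (A * exp (B * norm w))"
  proof -
    have "log_concave_ennreal ?G"
      using tent_support[of 2 "tent 2" "\<lambda>_. 1"] \<nu>
      by (intro convolve_log_concave log_concave_tent continuous_tent) auto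
    moreover have "?G x < \<infinity>" for x
      using near[of x x] radon_measure_cball_finite[OF rad, of x 3] by (auto intro: le_less_trans)
    ultimately show thesis
      using log_concave_exponential_growth[of ?G, OF _ _ near'] that by blast
  qed
  define v where "v = emeasure lborel (cball (0::'a) 1)"
  have v: "v \<noteq> 0" "v \<noteq> \<infinity>"
    using emeasure_lborel_cball_finite[of "0::'a" 1] content_cball_pos[of 1 "0::'a"]
    by (auto simp: v_def measure_def)
  have vol: "emeasure lborel (cball y 1) = v" for y :: 'a
  proof -
    have "measure lborel (cball y 1) = measure lborel (cball (0::'a) 1)"
      using content_ball_conv_unit_ball[of 1 y] by (simp add: content_cball_conv_ball)
    then show ?thesis
      using emeasure_lborel_cball_finite[of y 1] emeasure_lborel_cball_finite[of "0::'a" 1]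
      by (simp add: v_def emeasure_eq_ennreal_measure less_top)
  qed
  have lower: "ennreal (exp (- c) / 2) * v * ennreal (gaussian c y)
      \<le> (\<integral>\<^sup>+w. ennreal (gaussian (c / 2) w * tent 2 (w - y)) \<partial>lborel)" for y :: 'a
  proof -
    have "ennreal (exp (- c) / 2) * v * ennreal (gaussian c y)
        = ennreal (exp (- c) / 2 * gaussian c y) * emeasure lborel (cball y 1)"
      unfolding vol by (subst ennreal_mult) (auto simp: gaussian_def ac_simps)
    also have "\<dots> = (\<integral>\<^sup>+w. ennreal (exp (- c) / 2 * gaussian c y) * indicator (cball y 1) w \<partial>lborel)"
      by (simp add: nn_integral_cmult_indicator)
    also have "\<dots> \<le> (\<integral>\<^sup>+w. ennreal (gaussian (c / 2) w * tent 2 (w - y)) \<partial>lborel)"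
    proof (intro nn_integral_mono)
      fix w
      show "ennreal (exp (- c) / 2 * gaussian c y) * indicator (cball y 1) w
          \<le> ennreal (gaussian (c / 2) w * tent 2 (w - y))"
      proof (cases "w \<in> cball y 1")
        case True
        then have wy: "norm (w - y) \<le> 1" by (simp add: dist_norm norm_minus_commute)
        have "norm w \<le> norm y + 1" using norm_triangle_ineq2[of w y] wy by simp
        then have "(norm w)\<^sup>2 \<le> (norm y + 1)\<^sup>2" by (intro power_mono) auto
        also have "\<dots> \<le> 2 * (norm y)\<^sup>2 + 2"
          using zero_le_power2[of "norm y - 1"] by (simp add: power2_eq_square algebra_simps)
        finally have "(c / 2) * (norm w)\<^sup>2 \<le> (c / 2) * (2 * (norm y)\<^sup>2 + 2)"
          using c by (intro mult_left_mono) auto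
        then have "exp (- c) * gaussian c y \<le> gaussian (c / 2) w"
          by (simp add: gaussian_def algebra_simps flip: exp_add)
        moreover have "1 / 2 \<le> tent 2 (w - y)" using wy by (simp add: tent_def)
        ultimately have "(exp (- c) * gaussian c y) * (1 / 2) \<le> gaussian (c / 2) w * tent 2 (w - y)"
          by (intro mult_mono) (auto simp: gaussian_def)
        then show ?thesis using True by (auto intro!: ennreal_leI)
      qed simp
    qed
    finally show ?thesis .
  qed
  have "ennreal (exp (- c) / 2) * v * (\<integral>\<^sup>+y. ennreal (gaussian c y) \<partial>\<nu>)
      = (\<integral>\<^sup>+y. ennreal (exp (- c) / 2) * v * ennreal (gaussian c y) \<partial>\<nu>)"
    by (rule nn_integral_cmult[symmetric]) measurable
  also have "\<dots> \<le> (\<integral>\<^sup>+y. \<integral>\<^sup>+w. ennreal (gaussian (c / 2) w * tent 2 (w - y)) \<partial>lborel \<partial>\<nu>)"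
    by (intro nn_integral_mono lower)
  also have "\<dots> = (\<integral>\<^sup>+w. \<integral>\<^sup>+y. ennreal (gaussian (c / 2) w * tent 2 (w - y)) \<partial>\<nu> \<partial>lborel)"
    by (rule P.Fubini') measurable
  also have "\<dots> = (\<integral>\<^sup>+w. ennreal (gaussian (c / 2) w) * ?G w \<partial>lborel)"
  proof (intro nn_integral_cong)
    fix w
    have "(\<integral>\<^sup>+y. ennreal (gaussian (c / 2) w * tent 2 (w - y)) \<partial>\<nu>)
        = (\<integral>\<^sup>+y. ennreal (gaussian (c / 2) w) * ennreal (tent 2 (w - y)) \<partial>\<nu>)"
      by (intro nn_integral_cong ennreal_mult) (auto simp: gaussian_def tent_def)
    also have "\<dots> = ennreal (gaussian (c / 2) w) * ?G w"
      by (rule nn_integral_cmult) measurable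
    finally show "(\<integral>\<^sup>+y. ennreal (gaussian (c / 2) w * tent 2 (w - y)) \<partial>\<nu>)
        = ennreal (gaussian (c / 2) w) * ?G w" .
  qed
  also have "\<dots> \<le> (\<integral>\<^sup>+w. ennreal (A * exp (B\<^sup>2 / c)) * ennreal (gaussian (c / 4) (w::'a)) \<partial>lborel)"
  proof (intro nn_integral_mono)
    fix w :: 'a
    \<comment> \<open>Half of the Gaussian rate absorbs the exponential growth.\<close>
    have "- (c / 2 * (norm w)\<^sup>2) + B * norm w \<le> B\<^sup>2 / c - c / 4 * (norm w)\<^sup>2"
    proof -
      have "0 \<le> (c * norm w / 2 - B)\<^sup>2 / c" using c by simp
      also have "\<dots> = c / 4 * (norm w)\<^sup>2 - B * norm w + B\<^sup>2 / c"
        using c by (simp add: power2_eq_square field_simps)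
      finally show ?thesis by (simp add: algebra_simps)
    qed
    then have "exp (- (c / 2 * (norm w)\<^sup>2) + B * norm w) \<le> exp (B\<^sup>2 / c - c / 4 * (norm w)\<^sup>2)" by simp
    then have "gaussian (c / 2) w * exp (B * norm w) \<le> exp (B\<^sup>2 / c) * gaussian (c / 4) w"
      by (simp only: gaussian_def flip: exp_add) simp
    from mult_left_mono[OF this AB(1)]
    have le: "gaussian (c / 2) w * (A * exp (B * norm w)) \<le> A * exp (B\<^sup>2 / c) * gaussian (c / 4) w"
      by (simp add: ac_simps)
    have "ennreal (gaussian (c / 2) w) * ?G w \<le> ennreal (gaussian (c / 2) w) * ennreal (A * exp (B * norm w))"
      by (intro mult_left_mono AB) auto
    also have "\<dots> = ennreal (gaussian (c / 2) w * (A * exp (B * norm w)))"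
      using AB by (intro ennreal_mult[symmetric]) (auto simp: gaussian_def)
    also have "\<dots> \<le> ennreal (A * exp (B\<^sup>2 / c) * gaussian (c / 4) w)" using le by (rule ennreal_leI)
    also have "\<dots> = ennreal (A * exp (B\<^sup>2 / c)) * ennreal (gaussian (c / 4) w)"
      using AB by (intro ennreal_mult) (auto simp: gaussian_def)
    finally show "ennreal (gaussian (c / 2) w) * ?G w \<le> ennreal (A * exp (B\<^sup>2 / c)) * ennreal (gaussian (c / 4) w)" .
  qed
  also have "\<dots> = ennreal (A * exp (B\<^sup>2 / c)) * (\<integral>\<^sup>+w. ennreal (gaussian (c / 4) (w::'a)) \<partial>lborel)"
    by (rule nn_integral_cmult) measurable
  also have "\<dots> < \<infinity>"
    using gaussian_integral_finite[of "c / 4", where 'a = 'a] c by (simp add: ennreal_mult_less_top)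
  finally have "ennreal (exp (- c) / 2) * v * (\<integral>\<^sup>+y. ennreal (gaussian c y) \<partial>\<nu>) < \<infinity>" .
  then show ?thesis using v by (auto simp: ennreal_mult_less_top ennreal_zero_less_mult_iff)
qed

text \<open>From \<open>|y|\<^sup>2 \<le> 2 |x - y|\<^sup>2 + 2 |x|\<^sup>2\<close>. The right-hand side makes the bound locally uniform in \<open>x\<close>.\<close>

lemma convolve_gaussian_bound:
  fixes \<nu> :: "'a::euclidean_space measure"
  assumes \<nu>: "log_concave_measure \<nu>" and c: "0 < c"
  shows "convolve (gaussian c) \<nu> x \<le> ennreal (exp (c * (norm x)\<^sup>2)) * (\<integral>\<^sup>+y. ennreal (gaussian (c / 2) y) \<partial>\<nu>)"
proof -
  have rad: "radon_measure \<nu>" using \<nu> by (simp add: log_concave_measure_def)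
  note [measurable_cong] = radon_measure_sets[OF rad]
  have "convolve (gaussian c) \<nu> x \<le> (\<integral>\<^sup>+y. ennreal (exp (c * (norm x)\<^sup>2)) * ennreal (gaussian (c / 2) y) \<partial>\<nu>)"
  proof (intro nn_integral_mono)
    fix y
    have "norm y \<le> norm (x - y) + norm x" using norm_triangle_ineq2[of y x] by (simp add: norm_minus_commute)
    then have "(norm y)\<^sup>2 \<le> (norm (x - y) + norm x)\<^sup>2" by (intro power_mono) auto
    also have "\<dots> \<le> 2 * (norm (x - y))\<^sup>2 + 2 * (norm x)\<^sup>2"
      using zero_le_power2[of "norm (x - y) - norm x"] by (simp add: power2_eq_square algebra_simps)
    finally have "(c / 2) * (norm y)\<^sup>2 \<le> (c / 2) * (2 * (norm (x - y))\<^sup>2 + 2 * (norm x)\<^sup>2)"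
      using c by (intro mult_left_mono) auto
    then have "gaussian c (x - y) \<le> exp (c * (norm x)\<^sup>2) * gaussian (c / 2) y"
      by (simp add: gaussian_def algebra_simps flip: exp_add)
    then have "ennreal (gaussian c (x - y)) \<le> ennreal (exp (c * (norm x)\<^sup>2) * gaussian (c / 2) y)"
      by (rule ennreal_leI)
    then show "ennreal (gaussian c (x - y)) \<le> ennreal (exp (c * (norm x)\<^sup>2)) * ennreal (gaussian (c / 2) y)"
      by (simp add: ennreal_mult gaussian_def)
  qed
  also have "\<dots> = ennreal (exp (c * (norm x)\<^sup>2)) * (\<integral>\<^sup>+y. ennreal (gaussian (c / 2) y) \<partial>\<nu>)"
    by (rule nn_integral_cmult) measurable
  finally show ?thesis .
qed

section \<open>Gaussian convolution of super log-concave measures\<close>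

lemma has_log_concave_density_density:
  fixes H :: "'a::euclidean_space \<Rightarrow> ennreal"
  assumes H: "log_concave_ennreal H" and fin: "\<And>x. H x < \<infinity>" and [measurable]: "H \<in> borel_measurable borel"
  shows "has_log_concave_density (density lborel H)"
  unfolding has_log_concave_density_def
proof (intro bexI conjI)
  show "log_concave_fun (\<lambda>x. enn2real (H x))" by (rule log_concave_fun_enn2real[OF H fin])
  show "density lborel H = density lborel (\<lambda>x. ennreal (enn2real (H x)))"
    using fin by (intro density_cong) (auto simp: less_top)
qed measurable

text \<open>The function \<open>(z, x) \<mapsto> \<theta>(z - x) F(x)\<close> is jointly log-concave, and its integral over \<open>x\<close> is the convolution of
  \<open>\<theta>\<close> with the measure; so this is Prekopa's theorem. Local boundedness of \<open>F\<close> makes the measure Radon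
  and the convolution finite.\<close>

lemma log_concave_measure_density:
  fixes F :: "'a::euclidean_space \<Rightarrow> real"
  assumes F: "log_concave_fun F" and [measurable]: "F \<in> borel_measurable borel"
    and bound: "\<And>r. \<exists>M. \<forall>x. norm x \<le> r \<longrightarrow> F x \<le> M"
  shows "log_concave_measure (density lborel (\<lambda>x. ennreal (F x)))"
  unfolding log_concave_measure_def
proof (intro conjI allI impI)
  have F0: "0 \<le> F x" for x using F by (simp add: log_concave_fun_def)
  show rad: "radon_measure (density lborel (\<lambda>x. ennreal (F x)))"
    using bound by (intro radon_measure_density) (auto intro: ennreal_leI, metis ennreal_leI)
  fix \<theta> :: "'a \<Rightarrow> real"
  assume \<theta>: "log_concave_fun \<theta>" "continuous_on UNIV \<theta>" "compact (closure {x. \<theta> x \<noteq> 0})"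
  have \<theta>0: "0 \<le> \<theta> x" for x using \<theta> by (simp add: log_concave_fun_def)
  have [measurable]: "\<theta> \<in> borel_measurable borel" using \<theta> by (rule_tac borel_measurable_continuous_onI)
  let ?\<mu> = "density lborel (\<lambda>x. ennreal (F x))"
  have eq: "convolve \<theta> ?\<mu> z = (\<integral>\<^sup>+x. ennreal (\<theta> (z - x) * F x) \<partial>lborel)" for z
    using F0 \<theta>0 by (subst nn_integral_density) (auto simp: ennreal_mult mult.commute intro!: nn_integral_cong)
  have "log_concave_fun (\<lambda>p. \<theta> (fst p - snd p) * F (snd p))"
    by (intro log_concave_fun_mult log_concave_fun_affine[OF \<theta>(1)] log_concave_fun_affine[OF F])
      (auto simp: algebra_simps)
  moreover have "(\<lambda>p. ennreal (\<theta> (fst p - snd p) * F (snd p))) \<in> borel_measurable (borel :: ('a \<times> 'a) measure)"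
    unfolding borel_prod[symmetric] by measurable
  ultimately have "log_concave_ennreal (\<lambda>z. \<integral>\<^sup>+x. ennreal (\<theta> (z - x) * F x) \<partial>lborel)"
    using Prekopa[of "\<lambda>p. ennreal (\<theta> (fst p - snd p) * F (snd p))"] log_concave_ennreal_of_fun by fastforce
  then have lc: "log_concave_ennreal (convolve \<theta> ?\<mu>)" by (simp add: eq)
  have fin: "convolve \<theta> ?\<mu> z < \<infinity>" for z
  proof -
    obtain M r where M: "0 \<le> M" "0 \<le> r" "\<And>x. \<theta> x \<le> M * indicator (cball 0 r) x"
      using compact_support_bound[OF \<theta>(2,3)] by blast
    have "convolve \<theta> ?\<mu> z \<le> (\<integral>\<^sup>+x. ennreal M * indicator (cball z r) x \<partial>?\<mu>)"
    proof (intro nn_integral_mono)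
      fix x
      show "ennreal (\<theta> (z - x)) \<le> ennreal M * indicator (cball z r) x"
        using M(3)[of "z - x"]
        by (cases "dist z x \<le> r") (auto simp: indicator_def dist_norm norm_minus_commute[of x z] ennreal_leI ennreal_neg)
    qed
    also have "\<dots> = ennreal M * emeasure ?\<mu> (cball z r)"
      by (rule nn_integral_cmult_indicator) simp
    also have "\<dots> < \<infinity>"
      using radon_measure_cball_finite[OF rad, of z r] by (simp add: ennreal_mult_less_top)
    finally show ?thesis .
  qed
  show "has_log_concave_density (conv_measure \<theta> ?\<mu>)"
    unfolding conv_measure_def
    by (rule has_log_concave_density_density[OF lc fin measurable_convolve[OF rad]]) measurable
qed

text \<open>The last summand is the minimum of the left-hand side over \<open>y\<close>, the infimal convolution of the two
  quadratic forms. Its coefficient \<open>\<alpha> / (2 (1 + \<alpha> \<sigma>)) = (1/2) / (\<sigma> + 1/\<alpha>)\<close> is half the supremum of the admissible \<open>\<delta>\<close>.\<close>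

lemma complete_the_square:
  fixes x y :: "'a::real_inner" and \<alpha> \<sigma> :: real
  assumes "0 < \<alpha>" "0 < \<sigma>"
  shows "1 / (2 * \<sigma>) * (norm (x - y))\<^sup>2 + \<alpha> / 2 * (norm y)\<^sup>2
    = (1 + \<alpha> * \<sigma>) / (2 * \<sigma>) * (norm ((1 / (1 + \<alpha> * \<sigma>)) *\<^sub>R x - y))\<^sup>2
      + \<alpha> / (2 * (1 + \<alpha> * \<sigma>)) * (norm x)\<^sup>2"
proof -
  define k where "k = 1 + \<alpha> * \<sigma>"
  have k: "0 < k" "\<alpha> = (k - 1) / \<sigma>" using assms by (auto simp: k_def add_pos_pos)
  have expand: "(norm (u - y))\<^sup>2 = (norm u)\<^sup>2 - 2 * (u \<bullet> y) + (norm y)\<^sup>2" for u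
    by (simp add: power2_norm_eq_inner inner_diff_left inner_diff_right inner_commute)
  show ?thesis
    unfolding expand k_def[symmetric] norm_scaleR power_mult_distrib inner_scaleR_left
    unfolding k(2) using k(1) assms by (simp add: field_simps power2_eq_square)
qed

text \<open>With \<open>\<nu> = exp (\<alpha> |y|\<^sup>2 / 2) \<rho>(dy)\<close>, completing the square shows that the density of the convolution is a
  Gaussian of rate \<open>\<beta>\<close> times \<open>\<Phi>(\<kappa> x)\<close>, where \<open>\<Phi>\<close> is a Gaussian convolved with \<open>\<nu>\<close>. The weight
  \<open>exp (\<delta> |x|\<^sup>2 / 2)\<close> lowers the rate \<open>\<beta>\<close> by \<open>\<delta> / 2\<close>, and what remains is log-concave as long as the rate
  does not become negative.\<close>

lemma super_log_concave_measure_conv_gauss_kernel: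
  fixes \<rho> :: "'a::euclidean_space measure"
  assumes \<alpha>: "\<alpha> > 0" and \<sigma>: "\<sigma> > 0" and \<rho>: "super_log_concave_measure \<alpha> \<rho>"
    and \<delta>: "\<delta> > 0" and gap: "1 / \<delta> - 1 / \<alpha> \<ge> \<sigma>"
  shows "super_log_concave_measure \<delta> (conv_measure (gauss_kernel \<sigma>) \<rho>)"
proof -
  define \<nu> where "\<nu> = density \<rho> (\<lambda>x. ennreal (exp (\<alpha> / 2 * (norm x)\<^sup>2)))"
  have \<nu>: "log_concave_measure \<nu>" and rad\<rho>: "radon_measure \<rho>"
    using \<rho> by (auto simp: super_log_concave_measure_def \<nu>_def)
  have rad\<nu>: "radon_measure \<nu>" using \<nu> by (simp add: log_concave_measure_def)
  note [measurable_cong] = radon_measure_sets[OF rad\<rho>] radon_measure_sets[OF rad\<nu>]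
  define c where "c = (1 + \<alpha> * \<sigma>) / (2 * \<sigma>)"
  define \<kappa> where "\<kappa> = 1 / (1 + \<alpha> * \<sigma>)"
  define \<beta> where "\<beta> = \<alpha> / (2 * (1 + \<alpha> * \<sigma>))"
  have pos: "0 < 1 + \<alpha> * \<sigma>" using \<alpha> \<sigma> by (simp add: add_pos_pos)
  have c: "0 < c" using pos \<sigma> by (simp add: c_def)
  \<comment> \<open>The only place where the gap between \<open>1 / \<delta>\<close> and \<open>1 / \<alpha>\<close> enters.\<close>
  have \<beta>: "\<delta> / 2 \<le> \<beta>"
    using gap \<alpha> \<sigma> \<delta> pos by (simp add: \<beta>_def field_simps)
  let ?\<Phi> = "convolve (gaussian c) \<nu>"
  have lc\<Phi>: "log_concave_ennreal ?\<Phi>" using c by (intro convolve_gaussian_log_concave[OF \<nu>]) auto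
  have [measurable]: "?\<Phi> \<in> borel_measurable borel" by (rule measurable_convolve[OF rad\<nu>]) measurable
  define I where "I = enn2real (\<integral>\<^sup>+y. ennreal (gaussian (c / 2) y) \<partial>\<nu>)"
  have \<Phi>_bound: "?\<Phi> x \<le> ennreal (exp (c * (norm x)\<^sup>2) * I)" for x
    using convolve_gaussian_bound[OF \<nu> c, of x] log_concave_measure_gaussian_integral_finite[OF \<nu>, of "c / 2"] c
    by (simp add: I_def ennreal_mult less_top)
  have fin: "?\<Phi> x < \<infinity>" for x by (rule le_less_trans[OF \<Phi>_bound]) simp
  define P where "P x = gaussian \<beta> x * enn2real (?\<Phi> (\<kappa> *\<^sub>R x))" for x
  have P0: "0 \<le> P x" for x by (simp add: P_def gaussian_def)
  have [measurable]: "P \<in> borel_measurable borel" unfolding P_def by measurable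
  have density: "convolve (gauss_kernel \<sigma>) \<rho> x = ennreal (P x)" for x
  proof -
    have split: "gauss_kernel \<sigma> (x - y) = gaussian \<beta> x * (exp (\<alpha> / 2 * (norm y)\<^sup>2) * gaussian c (\<kappa> *\<^sub>R x - y))" for y
    proof -
      have "- (1 / (2 * \<sigma>)) * (norm (x - y))\<^sup>2
          = - (\<beta> * (norm x)\<^sup>2) + (\<alpha> / 2 * (norm y)\<^sup>2 + - (c * (norm (\<kappa> *\<^sub>R x - y))\<^sup>2))"
        using complete_the_square[OF \<alpha> \<sigma>, of x y] unfolding c_def \<kappa>_def \<beta>_def by linarith
      then show ?thesis unfolding gauss_kernel_def gaussian_def exp_add[symmetric] by simp
    qed
    have "convolve (gauss_kernel \<sigma>) \<rho> x
        = (\<integral>\<^sup>+y. ennreal (gaussian \<beta> x) * (ennreal (exp (\<alpha> / 2 * (norm y)\<^sup>2)) * ennreal (gaussian c (\<kappa> *\<^sub>R x - y))) \<partial>\<rho>)"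
      unfolding split by (intro nn_integral_cong) (simp add: ennreal_mult gaussian_def)
    also have "\<dots> = ennreal (gaussian \<beta> x) * (\<integral>\<^sup>+y. ennreal (exp (\<alpha> / 2 * (norm y)\<^sup>2)) * ennreal (gaussian c (\<kappa> *\<^sub>R x - y)) \<partial>\<rho>)"
      by (rule nn_integral_cmult) measurable
    also have "\<dots> = ennreal (gaussian \<beta> x) * ?\<Phi> (\<kappa> *\<^sub>R x)"
      unfolding \<nu>_def by (subst nn_integral_density) measurable
    also have "\<dots> = ennreal (P x)"
      using fin[of "\<kappa> *\<^sub>R x"] by (simp add: P_def ennreal_mult gaussian_def less_top)
    finally show ?thesis .
  qed
  have P_bound: "\<exists>M. \<forall>x. norm x \<le> r \<longrightarrow> P x \<le> M" for r
  proof (intro exI allI impI)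
    fix x :: 'a assume "norm x \<le> r"
    have "0 \<le> \<beta>" using \<beta> \<delta> by simp
    then have "gaussian \<beta> x \<le> 1" by (simp add: gaussian_def)
    moreover have "enn2real (?\<Phi> (\<kappa> *\<^sub>R x)) \<le> exp (c * (norm (\<kappa> *\<^sub>R x))\<^sup>2) * I"
      using \<Phi>_bound[of "\<kappa> *\<^sub>R x"] by (intro enn2real_leI) (auto simp: I_def)
    moreover have "\<dots> \<le> exp (c * (\<bar>\<kappa>\<bar> * r)\<^sup>2) * I"
      using \<open>norm x \<le> r\<close> c by (auto intro!: mult_right_mono mult_left_mono power_mono simp: I_def)
    ultimately show "P x \<le> 1 * (exp (c * (\<bar>\<kappa>\<bar> * r)\<^sup>2) * I)"
      unfolding P_def by (intro mult_mono) auto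
  qed
  have conv: "conv_measure (gauss_kernel \<sigma>) \<rho> = density lborel (\<lambda>x. ennreal (P x))"
    unfolding conv_measure_def by (simp add: density)
  define F where "F x = gaussian (\<beta> - \<delta> / 2) x * enn2real (?\<Phi> (\<kappa> *\<^sub>R x))" for x
  have F_P: "P x * exp (\<delta> / 2 * (norm x)\<^sup>2) = F x" for x
    by (simp add: P_def F_def gaussian_def algebra_simps flip: exp_add)
  have "density (conv_measure (gauss_kernel \<sigma>) \<rho>) (\<lambda>x. ennreal (exp (\<delta> / 2 * (norm x)\<^sup>2)))
      = density lborel (\<lambda>x. ennreal (F x))"
    unfolding conv by (subst density_density_eq) (auto simp: P0 simp flip: F_P ennreal_mult)
  moreover have "log_concave_measure (density lborel (\<lambda>x. ennreal (F x)))"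
  proof (rule log_concave_measure_density)
    show "log_concave_fun F"
      unfolding F_def using \<beta>
      by (intro log_concave_fun_mult log_concave_gaussian log_concave_fun_affine[OF log_concave_fun_enn2real[OF lc\<Phi> fin]])
        (auto simp: algebra_simps)
    show "F \<in> borel_measurable borel" unfolding F_def by measurable
    fix r
    obtain M where M: "\<And>x::'a. norm x \<le> r \<Longrightarrow> P x \<le> M" using P_bound by blast
    show "\<exists>M. \<forall>x. norm x \<le> r \<longrightarrow> F x \<le> M"
    proof (intro exI allI impI)
      fix x :: 'a assume x: "norm x \<le> r"
      show "F x \<le> M * exp (\<delta> / 2 * r\<^sup>2)"
        unfolding F_P[symmetric] using M[OF x] P0[of x] x \<delta>
        by (intro mult_mono) (auto intro!: power_mono mult_left_mono)
    qed
  qed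
  moreover have "radon_measure (conv_measure (gauss_kernel \<sigma>) \<rho>)"
    unfolding conv
  proof (rule radon_measure_density)
    fix r show "\<exists>M. \<forall>x. norm x \<le> r \<longrightarrow> ennreal (P x) \<le> ennreal M"
      using P_bound[of r] by (auto intro: ennreal_leI)
  qed measurable
  ultimately show ?thesis by (simp add: super_log_concave_measure_def)
qed

theorem lemma3:
  fixes \<alpha> \<sigma> \<delta> :: real and \<rho> :: "(real ^ 'd) measure"
  assumes "\<alpha> > 0" and "\<sigma> > 0"
    and "super_log_concave_measure \<alpha> \<rho>"
    and "\<delta> > 0" and "1 / \<delta> - 1 / \<alpha> > \<sigma>"
  shows "super_log_concave_measure \<delta> (conv_measure (gauss_kernel \<sigma>) \<rho>)"
  using assms by (intro super_log_concave_measure_conv_gauss_kernel[of \<alpha> \<sigma>]) auto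

end
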